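(* Assume that the Compatibility Assumption (stated in the context) holds and that the loss $\ell$ is $\Sigma^2$-subgaussian. Let $\zeta\in(0,1)$. Then, with probability at least $1-\zeta$ over $S\sim\mu_z^{\otimes n}$, for all $T>0$, $$\mathbb E\left[G_S(Y_T^S)\mid S\right]\le\frac{2\Sigma}{\sqrt n}\left\{\int_0^T\Delta_{P,P_S}(v_t)\,dt+\mathrm{KL}(\mu_0\|\pi)+\log(3/\zeta)\right\}^{1/2}.$$
   Context: $\mathcal P(\mathbb R^d)$ is the set of Borel probability measures on $\mathbb R^d$. For a Markov kernel $K$ on $\mathbb R^d$: $Kf(x)=\int f(y)\,K(x,dy)$ and $\mu K(A)=\int K(x,A)\,d\mu(x)$. $(\mathcal Z,\mathcal F)$ is a measurable space with a probability measure $\mu_z$, $n\ge1$, $\ell:\mathbb R^d\times\mathcal Z\to\mathbb R_+$ is a loss. For $S=(z_1,\dots,z_n)\in\mathcal Z^n$: $\mathcal R(w)=\int\ell(w,z)\,d\mu_z(z)$, $\widehat{\mathcal R}_S(w)=\frac1n\sum_i\ell(w,z_i)$, $G_S=\mathcal R-\widehat{\mathcal R}_S$. The loss is $\Sigma^2$-subgaussian if for all $w\in\mathbb R^d$ and all $\lambda\in\mathbb R$, $\mathbb E_{Z\sim\mu_z}[e^{\lambda(\ell(w,Z)-\mathcal R(w))}]\le e^{\lambda^2\Sigma^2/2}$. For each $S\in\mathcal Z^n$, $(X^S_k)_{k\in\mathbb N}$ is a time-homogeneous Markov chain on $\mathbb R^d$ with Markov kernel $P_S$ and initial law $\mu_0\in\mathcal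 P(\mathbb R^d)$. $(N_t)_{t\ge0}$ is a Poisson process of intensity $1$ independent of all other random variables; $Y^S_t:=X^S_{N_t}$ and $\rho_t^S$ is the law of $Y_t^S$ given $S$. Prior: $P$ is a Markov kernel on $\mathbb R^d$ not depending on $S$, and $\pi\in\mathcal P(\mathbb R^d)$ satisfies $\pi P=\pi$. It is assumed that $\mu_0\ll\pi$. Write $v_t:=\frac{d\rho_t^S}{d\pi}$, and define the expansion term $\Delta_{P,P_S}(f):=\int f\,(P_S-P)(\log f)\,d\pi$ whenever defined. Dual operator: if $K$ is a Markov kernel such that $\mu\ll\pi\Rightarrow\mu K\ll\pi$, then $K^\star:L^1(\pi)\to L^1(\pi)$ is defined on non-negative $f$ with $\int f\,d\pi=1$ by $K^\star f=\frac{d(\mu K)}{d\pi}$ with $d\mu=f\,d\pi$, and extended linearly. Compatibility Assumption: $\mathrm{KL}(\mu_0\|\pi)<+\infty$; $v_0=d\mu_0/d\pi$ is bounded away from $0$; for all $t\ge0$ the map $S\mapsto\mathrm{KL}(\rho_t^S\|\pi)$ is $\mathcal F^{\otimes n}$-measurable; and for all $S\in\mathcal Z^n$: (H.1) for all $\mu\in\mathcal P(\mathbb R^d)$, $\mu\ll\pi$ implies $\mu P_S\ll\pi$; (H.2) for all $t\ge0$, $\Phi(P_S^\star v_t)\in L^1(\pi)$, where $\Phi(x)=x\log x$, $\Phi(0)=0$. *)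

theory Defs
  imports "HOL-Probability.Probability"
begin

definition risk :: "'z measure \<Rightarrow> ('a \<Rightarrow> 'z \<Rightarrow> real) \<Rightarrow> 'a \<Rightarrow> real" where
  "risk \<mu>z l w = (\<integral>z. l w z \<partial>\<mu>z)"

definition empirical_risk :: "nat \<Rightarrow> ('a \<Rightarrow> 'z \<Rightarrow> real) \<Rightarrow> (nat \<Rightarrow> 'z) \<Rightarrow> 'a \<Rightarrow> real" where
  "empirical_risk n l S w = (\<Sum>i<n. l w (S i)) / real n"

definition gen_gap ::
  "'z measure \<Rightarrow> nat \<Rightarrow> ('a \<Rightarrow> 'z \<Rightarrow> real) \<Rightarrow> (nat \<Rightarrow> 'z) \<Rightarrow> 'a \<Rightarrow> real" where
  "gen_gap \<mu>z n l S w = risk \<mu>z l w - empirical_risk n l S w"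

(* The expectation is a [0,\<infinity>]-valued integral, so that the bound asserts its finiteness.
   For nonnegative measurable losses this forces l w to be integrable: otherwise risk would take
   the default value 0 and exp (l w) would be integrable, contradicting l w \<le> exp (l w). *)
definition subgaussian_loss :: "'z measure \<Rightarrow> ('a \<Rightarrow> 'z \<Rightarrow> real) \<Rightarrow> real \<Rightarrow> bool" where
  "subgaussian_loss \<mu>z l \<Sigma> \<longleftrightarrow>
     (\<forall>w. \<forall>c::real. (\<integral>\<^sup>+z. ennreal (exp (c * (l w z - risk \<mu>z l w))) \<partial>\<mu>z)
                     \<le> ennreal (exp (c\<^sup>2 * \<Sigma>\<^sup>2 / 2)))"

(* P(X (k+1) \<in> A | X 0, ..., X k) = K (X k) A almost surely, with X 0 distributed as \<mu>0. *)
definition markov_chain ::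
  "'w measure \<Rightarrow> ('a::topological_space \<Rightarrow> 'a measure) \<Rightarrow> 'a measure \<Rightarrow> (nat \<Rightarrow> 'w \<Rightarrow> 'a) \<Rightarrow> bool" where
  "markov_chain M K \<mu>0 X \<longleftrightarrow>
     (\<forall>k. X k \<in> borel_measurable M) \<and>
     distr M borel (X 0) = \<mu>0 \<and>
     (\<forall>k. \<forall>A\<in>sets borel. AE \<omega> in M.
        real_cond_exp M
          (vimage_algebra (space M) (\<lambda>\<omega>. \<lambda>i\<in>{..k}. X i \<omega>) (Pi\<^sub>M {..k} (\<lambda>_. borel)))
          (\<lambda>\<omega>. indicator A (X (Suc k) \<omega>)) \<omega>
        = measure (K (X k \<omega>)) A)"

(* Only times t \<ge> 0 matter. Truncated subtraction on nat is harmless: almost all paths are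
   nondecreasing. *)
definition poisson_process :: "'w measure \<Rightarrow> real \<Rightarrow> (real \<Rightarrow> 'w \<Rightarrow> nat) \<Rightarrow> bool" where
  "poisson_process M r N \<longleftrightarrow>
     (\<forall>t\<ge>0. N t \<in> M \<rightarrow>\<^sub>M count_space UNIV) \<and>
     (AE \<omega> in M. N 0 \<omega> = 0 \<and> mono_on {0..} (\<lambda>t. N t \<omega>) \<and>
        (\<forall>t\<ge>0. ((\<lambda>s. N s \<omega>) \<longlongrightarrow> N t \<omega>) (at_right t))) \<and>
     (\<forall>s t. 0 \<le> s \<longrightarrow> s < t \<longrightarrow>
        distr M (count_space UNIV) (\<lambda>\<omega>. N t \<omega> - N s \<omega>) = measure_pmf (poisson_pmf (r * (t - s)))) \<and>
     (\<forall>(m::nat) \<tau>. 0 \<le> \<tau> 0 \<longrightarrow> mono_on {..m} \<tau> \<longrightarrow>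
        prob_space.indep_vars M (\<lambda>_. count_space UNIV)
          (\<lambda>i \<omega>. N (\<tau> (Suc i)) \<omega> - N (\<tau> i) \<omega>) {..<m})"

definition indep_processes ::
  "'w measure \<Rightarrow> (nat \<Rightarrow> 'w \<Rightarrow> 'a::topological_space) \<Rightarrow> (real \<Rightarrow> 'w \<Rightarrow> nat) \<Rightarrow> bool" where
  "indep_processes M X N \<longleftrightarrow>
     prob_space.indep_set M
       (sets (vimage_algebra (space M) (\<lambda>\<omega> k. X k \<omega>) (Pi\<^sub>M UNIV (\<lambda>_. borel))))
       (sets (vimage_algebra (space M) (\<lambda>\<omega>. \<lambda>t\<in>{0..}. N t \<omega>) (Pi\<^sub>M {0..} (\<lambda>_. count_space UNIV))))"

definition poissonized :: "(nat \<Rightarrow> 'w \<Rightarrow> 'a) \<Rightarrow> (real \<Rightarrow> 'w \<Rightarrow> nat) \<Rightarrow> real \<Rightarrow> 'w \<Rightarrow> 'a" where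
  "poissonized X N t \<omega> = X (N t \<omega>) \<omega>"

definition poissonized_law ::
  "'w measure \<Rightarrow> (nat \<Rightarrow> 'w \<Rightarrow> 'a::topological_space) \<Rightarrow> (real \<Rightarrow> 'w \<Rightarrow> nat) \<Rightarrow> real \<Rightarrow> 'a measure" where
  "poissonized_law M X N t = distr M borel (poissonized X N t)"

(* KL(\<mu> || \<pi>). For probability measures \<mu> \<ll> \<pi> the negative part of the log-density is always
   \<mu>-integrable, so failure of integrability means divergence to \<infinity>. *)
definition KL :: "'a measure \<Rightarrow> 'a measure \<Rightarrow> ereal" where
  "KL \<mu> \<pi> = (if absolutely_continuous \<pi> \<mu> \<and> integrable \<mu> (entropy_density (exp 1) \<pi> \<mu>)
             then ereal (KL_divergence (exp 1) \<pi> \<mu>) else \<infinity>)"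

definition dens :: "'a measure \<Rightarrow> 'a measure \<Rightarrow> 'a \<Rightarrow> real" where
  "dens \<pi> \<mu> x = enn2real (RN_deriv \<pi> \<mu> x)"

(* ennreal truncates negative reals to 0, so the two terms are the positive and negative part of f;
   the measure bind (density \<pi> f) K is (f \<pi>) K. *)
definition dual_op :: "'a measure \<Rightarrow> ('a \<Rightarrow> 'a measure) \<Rightarrow> ('a \<Rightarrow> real) \<Rightarrow> 'a \<Rightarrow> real" where
  "dual_op \<pi> K f x =
     dens \<pi> (bind (density \<pi> (\<lambda>y. ennreal (f y))) K) x
     - dens \<pi> (bind (density \<pi> (\<lambda>y. ennreal (- f y))) K) x"

definition expansion_term ::
  "'a measure \<Rightarrow> ('a \<Rightarrow> 'a measure) \<Rightarrow> ('a \<Rightarrow> 'a measure) \<Rightarrow> ('a \<Rightarrow> real) \<Rightarrow> real" where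
  "expansion_term \<pi> P Q f =
     (\<integral>x. f x * ((\<integral>y. ln (f y) \<partial>Q x) - (\<integral>y. ln (f y) \<partial>P x)) \<partial>\<pi>)"

definition expansion_defined ::
  "'a measure \<Rightarrow> ('a \<Rightarrow> 'a measure) \<Rightarrow> ('a \<Rightarrow> 'a measure) \<Rightarrow> ('a \<Rightarrow> real) \<Rightarrow> bool" where
  "expansion_defined \<pi> P Q f \<longleftrightarrow>
     (AE x in \<pi>. 0 < f x \<and> integrable (Q x) (\<lambda>y. ln (f y)) \<and> integrable (P x) (\<lambda>y. ln (f y))) \<and>
     integrable \<pi> (\<lambda>x. f x * ((\<integral>y. ln (f y) \<partial>Q x) - (\<integral>y. ln (f y) \<partial>P x)))"

(* \<rho> S t is the law of the process at time t for the data set S. In the last clause x * ln x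
   is 0 at x = 0 since ln 0 = 0. *)
definition compatibility ::
  "nat \<Rightarrow> 'z measure \<Rightarrow> 'a::topological_space measure \<Rightarrow> 'a measure \<Rightarrow>
   ((nat \<Rightarrow> 'z) \<Rightarrow> 'a \<Rightarrow> 'a measure) \<Rightarrow> ((nat \<Rightarrow> 'z) \<Rightarrow> real \<Rightarrow> 'a measure) \<Rightarrow> bool" where
  "compatibility n \<mu>z \<pi> \<mu>0 PS \<rho> \<longleftrightarrow>
     KL \<mu>0 \<pi> < \<infinity> \<and>
     (\<exists>c>0. AE x in \<pi>. c \<le> dens \<pi> \<mu>0 x) \<and>
     (\<forall>t\<ge>0. (\<lambda>S. KL (\<rho> S t) \<pi>) \<in> borel_measurable (Pi\<^sub>M {..<n} (\<lambda>_. \<mu>z))) \<and>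
     (\<forall>S\<in>space (Pi\<^sub>M {..<n} (\<lambda>_. \<mu>z)).
        (\<forall>\<mu>\<in>space (prob_algebra borel).
           absolutely_continuous \<pi> \<mu> \<longrightarrow> absolutely_continuous \<pi> (bind \<mu> (PS S))) \<and>
        (\<forall>t\<ge>0. integrable \<pi>
           (\<lambda>x. dual_op \<pi> (PS S) (dens \<pi> (\<rho> S t)) x * ln (dual_op \<pi> (PS S) (dens \<pi> (\<rho> S t)) x))))"

end

theory Submission
  imports Defs
begin

text \<open>Two facts are combined.

  PAC-Bayes: writing \<open>exp (b\<^sup>2 / 2)\<close> as a Gaussian average of \<open>exp (g b)\<close> and exchanging the integrals,
  subgaussianity of \<open>G\<^sub>S w\<close> gives \<open>E exp (n G\<^sub>S\<^sup>2 / (4 \<Sigma>\<^sup>2)) \<le> \<surd>2\<close>. Integrating against \<open>\<pi>\<close> and using Markov's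
  inequality, \<open>\<integral> exp (n G\<^sub>S\<^sup>2 / (4 \<Sigma>\<^sup>2)) d\<pi> \<le> 3 / \<zeta>\<close> outside an event of probability at most \<open>\<zeta>\<close>. On that
  single event the Donsker--Varadhan inequality bounds \<open>\<integral> G\<^sub>S\<^sup>2 d\<rho>\<close> for all \<open>\<rho> \<lless> \<pi>\<close> simultaneously,
  hence for all times.

  Entropy: the density \<open>v\<^sub>t\<close> of the Poissonized chain is the mixture \<open>e\<^sup>-\<^sup>t \<Sum> t\<^sup>k / k! u\<^sub>k\<close> and solves
  \<open>\<partial>\<^sub>t v = q - v\<close> pointwise, where \<open>q = P\<^sub>S\<^sup>* v\<close>. Since \<open>e\<^sup>t v\<^sub>t\<close> and \<open>e\<^sup>t q\<^sub>t\<close> increase in \<open>t\<close> and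
  \<open>v\<^sub>t \<le> u\<^sub>0 + t q\<^sub>t\<close>, the entropy assumptions bound everything in \<open>L log L\<close> uniformly on \<open>[0, T]\<close>, so
  the fundamental theorem of calculus and Fubini give
  \<open>KL(\<rho>\<^sub>T) - KL(\<mu>\<^sub>0) = \<integral>\<^sub>0\<^sup>T \<integral> (q\<^sub>t - v\<^sub>t) ln v\<^sub>t d\<pi> dt\<close>. Finally \<open>\<integral> v P(ln v) d\<pi> \<le> \<integral> v ln v d\<pi>\<close> because
  \<open>\<pi>\<close> is \<open>P\<close>-invariant, which replaces the inner integral by the expansion term.\<close>

subsection \<open>The class \<open>L log L\<close>\<close>

text \<open>Young's inequality for the pair x ln x and exp: when \<open>a\<close> and
  \<open>b\<close> both exceed 1 it reduces to \<open>ln (a / b) \<le> a / b - 1\<close>. It bounds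
  one density times the logarithm of another.\<close>

lemma mult_ln_pos_le:
  fixes a b :: real
  assumes "0 \<le> a" "0 \<le> b"
  shows "b * max 0 (ln a) \<le> b * max 0 (ln b) + a"
proof (cases "a \<le> 1 \<or> b = 0")
  case True
  then have "b * max 0 (ln a) = 0" using assms by (cases "a = 0") auto
  moreover have "0 \<le> b * max 0 (ln b)" using assms by simp
  ultimately show ?thesis using assms by linarith
next
  case False
  then have a: "a > 1" and b: "b > 0" using assms by auto
  show ?thesis
  proof (cases "b \<le> 1")
    case True
    have "b * ln a \<le> 1 * ln a" using True a by (intro mult_right_mono) auto
    also have "\<dots> \<le> a" using ln_le_minus_one[of a] a by simp
    finally have "b * ln a \<le> a" .
    moreover have "0 \<le> b * max 0 (ln b)" using b by simp
    ultimately show ?thesis using a by simp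
  next
    case False
    have "b * ln (a / b) \<le> b * (a / b - 1)"
      using ln_le_minus_one[of "a / b"] a b by (intro mult_left_mono) auto
    then show ?thesis using a b False by (simp add: ln_div algebra_simps)
  qed
qed

lemma mult_ln_pos_mono:
  fixes a b :: real
  assumes "0 \<le> a" "a \<le> b"
  shows "a * max 0 (ln a) \<le> b * max 0 (ln b)"
proof (cases "a = 0")
  case False
  then show ?thesis using assms by (intro mult_mono max.mono) auto
qed (use assms in simp)

lemma mult_ln_pos_scale:
  fixes a r :: real
  assumes "0 \<le> a" "0 < r"
  shows "(r * a) * max 0 (ln (r * a)) \<le> r * max 0 (ln r) * a + r * (a * max 0 (ln a))"
proof (cases "a = 0")
  case False
  then have "max 0 (ln (r * a)) \<le> max 0 (ln r) + max 0 (ln a)"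
    using assms by (simp add: ln_mult)
  then have "(r * a) * max 0 (ln (r * a)) \<le> (r * a) * (max 0 (ln r) + max 0 (ln a))"
    using assms by (intro mult_left_mono) auto
  then show ?thesis by (simp add: algebra_simps)
qed simp

text \<open>The sum is at most twice the larger summand and \<open>mult_ln_pos_mono\<close> applies,
  so one of the two nonnegative terms on the right already suffices.\<close>

lemma mult_ln_pos_add:
  fixes a b :: real
  assumes "0 \<le> a" "0 \<le> b"
  shows "(a + b) * max 0 (ln (a + b)) \<le> 2 * a * max 0 (ln (2 * a)) + 2 * b * max 0 (ln (2 * b))"
proof -
  have nn: "0 \<le> 2 * a * max 0 (ln (2 * a))" "0 \<le> 2 * b * max 0 (ln (2 * b))" using assms by auto
  show ?thesis
  proof (cases "a \<le> b")
    case True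
    then have "(a + b) * max 0 (ln (a + b)) \<le> 2 * b * max 0 (ln (2 * b))"
      using assms by (intro mult_ln_pos_mono) auto
    then show ?thesis using nn by linarith
  next
    case False
    then have "(a + b) * max 0 (ln (a + b)) \<le> 2 * a * max 0 (ln (2 * a))"
      using assms by (intro mult_ln_pos_mono) auto
    then show ?thesis using nn by linarith
  qed
qed

lemma mult_ln_ge:
  fixes a :: real
  assumes "0 \<le> a"
  shows "- 1 \<le> a * ln a"
proof (cases "a = 0")
  case False
  then have "ln (1 / a) \<le> 1 / a - 1" using assms by (intro ln_le_minus_one) auto
  then have "a * ln (1 / a) \<le> a * (1 / a - 1)" using assms by (intro mult_left_mono) auto
  then show ?thesis using False assms by (simp add: ln_div algebra_simps)
qed simp

text \<open>The positive part of the logarithm makes the integrand monotone in \<open>f\<close>,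
  unlike \<open>f x * ln (f x)\<close>, so that membership passes to smaller nonnegative measurable
  functions (\<open>LlogL_mono\<close>).\<close>

definition LlogL :: "'a measure \<Rightarrow> ('a \<Rightarrow> real) set" where
  "LlogL M = {f. (\<forall>x. 0 \<le> f x) \<and> integrable M f \<and> integrable M (\<lambda>x. f x * max 0 (ln (f x)))}"

lemma LlogL_mono:
  assumes "g \<in> LlogL M" "f \<in> borel_measurable M" "\<And>x. 0 \<le> f x" "\<And>x. f x \<le> g x"
  shows "f \<in> LlogL M"
proof -
  have [measurable]: "f \<in> borel_measurable M" "g \<in> borel_measurable M"
    using assms by (auto simp: LlogL_def)
  have le: "f x * max 0 (ln (f x)) \<le> g x * max 0 (ln (g x))" for x
    using assms by (intro mult_ln_pos_mono)
  have "integrable M f"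
    by (rule Bochner_Integration.integrable_bound[of M g]) (use assms in \<open>auto simp: LlogL_def\<close>)
  moreover have "integrable M (\<lambda>x. f x * max 0 (ln (f x)))"
    by (rule Bochner_Integration.integrable_bound[of M "\<lambda>x. g x * max 0 (ln (g x))"])
       (use assms le in \<open>auto simp: LlogL_def abs_mult\<close>)
  ultimately show ?thesis using assms by (auto simp: LlogL_def)
qed

lemma LlogL_scale:
  assumes f: "f \<in> LlogL M" and r: "0 < r"
  shows "(\<lambda>x. r * f x) \<in> LlogL M"
proof -
  have [measurable]: "f \<in> borel_measurable M" using f by (auto simp: LlogL_def)
  have "integrable M (\<lambda>x. (r * f x) * max 0 (ln (r * f x)))"
    by (rule Bochner_Integration.integrable_bound
          [of M "\<lambda>x. r * max 0 (ln r) * f x + r * (f x * max 0 (ln (f x)))"])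
       (use f r mult_ln_pos_scale[OF _ r] in \<open>auto simp: LlogL_def abs_mult\<close>)
  then show ?thesis using f r by (auto simp: LlogL_def)
qed

lemma LlogL_add:
  assumes "f \<in> LlogL M" "g \<in> LlogL M"
  shows "(\<lambda>x. f x + g x) \<in> LlogL M"
proof -
  have [measurable]: "f \<in> borel_measurable M" "g \<in> borel_measurable M"
    using assms by (auto simp: LlogL_def)
  have sc: "(\<lambda>x. 2 * f x) \<in> LlogL M" "(\<lambda>x. 2 * g x) \<in> LlogL M"
    using assms by (auto intro: LlogL_scale)
  have "integrable M (\<lambda>x. (f x + g x) * max 0 (ln (f x + g x)))"
    by (rule Bochner_Integration.integrable_bound
          [of M "\<lambda>x. 2 * f x * max 0 (ln (2 * f x)) + 2 * g x * max 0 (ln (2 * g x))"])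
       (use assms sc mult_ln_pos_add in \<open>auto simp: LlogL_def abs_mult\<close>)
  then show ?thesis using assms by (auto simp: LlogL_def)
qed

lemma LlogL_mult_ln:
  assumes "f \<in> LlogL M" "g \<in> LlogL M"
  shows "integrable M (\<lambda>x. g x * max 0 (ln (f x)))"
proof -
  have [measurable]: "f \<in> borel_measurable M" "g \<in> borel_measurable M"
    using assms by (auto simp: LlogL_def)
  show ?thesis
    by (rule Bochner_Integration.integrable_bound[of M "\<lambda>x. g x * max 0 (ln (g x)) + f x"])
       (use assms mult_ln_pos_le in \<open>auto simp: LlogL_def abs_mult\<close>)
qed

text \<open>By \<open>mult_ln_ge\<close> the negative part of x ln x is bounded by 1, hence
  integrable over a finite measure; only the positive part matters.\<close>

lemma (in finite_measure) LlogL_iff: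
  assumes "integrable M f" "\<And>x. 0 \<le> f x"
  shows "f \<in> LlogL M \<longleftrightarrow> integrable M (\<lambda>x. f x * ln (f x))"
proof -
  have [measurable]: "f \<in> borel_measurable M" using assms by auto
  have "integrable M (\<lambda>x. f x * ln (f x))" if "integrable M (\<lambda>x. f x * max 0 (ln (f x)))"
  proof (rule Bochner_Integration.integrable_bound[of M "\<lambda>x. f x * max 0 (ln (f x)) + 1"])
    show "AE x in M. norm (f x * ln (f x)) \<le> norm (f x * max 0 (ln (f x)) + 1)"
    proof (rule AE_I2)
      fix x
      have "f x * ln (f x) \<le> f x * max 0 (ln (f x))" using assms(2) by (intro mult_left_mono) auto
      moreover have "0 \<le> f x * max 0 (ln (f x))" using assms(2) by simp
      ultimately show "norm (f x * ln (f x)) \<le> norm (f x * max 0 (ln (f x)) + 1)"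
        using mult_ln_ge[OF assms(2)[of x]] by simp
    qed
  qed (use that in auto)
  moreover have "integrable M (\<lambda>x. f x * max 0 (ln (f x)))" if "integrable M (\<lambda>x. f x * ln (f x))"
    by (rule Bochner_Integration.integrable_bound[OF that])
       (use assms in \<open>auto simp: abs_mult intro!: mult_left_mono\<close>)
  ultimately show ?thesis using assms by (auto simp: LlogL_def)
qed

section \<open>Integration against Markov kernels\<close>

lemma integral_measurable_kernel:
  fixes f :: "'a \<Rightarrow> 'b \<Rightarrow> real"
  assumes f[measurable]: "(\<lambda>(x, y). f x y) \<in> borel_measurable (M \<Otimes>\<^sub>M N)"
    and L[measurable]: "L \<in> M \<rightarrow>\<^sub>M subprob_algebra N"
  shows "(\<lambda>x. \<integral>y. f x y \<partial>L x) \<in> borel_measurable M"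
proof -
  note integral_measurable_subprob_algebra[measurable] measurable_distr2[measurable]
  \<comment> \<open>The dependence of the integrand on \<open>x\<close> is moved into the measure:
    pushing \<open>L x\<close> forward under y -> (x, y) leaves one fixed integrand on the product
    space.\<close>
  have "(\<lambda>x. integral\<^sup>L (distr (L x) (M \<Otimes>\<^sub>M N) (\<lambda>y. (x, y))) (\<lambda>(x, y). f x y)) \<in> borel_measurable M"
    by measurable
  moreover have "integral\<^sup>L (distr (L x) (M \<Otimes>\<^sub>M N) (\<lambda>y. (x, y))) (\<lambda>(x, y). f x y) = (\<integral>y. f x y \<partial>L x)"
    if "x \<in> space M" for x
  proof (subst integral_distr)
    show "(\<lambda>y. (x, y)) \<in> L x \<rightarrow>\<^sub>M M \<Otimes>\<^sub>M N"
      using measurable_Pair1'[OF that] unfolding measurable_cong_sets[OF sets_kernel[OF L that] refl] .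
  qed auto
  ultimately show ?thesis by (subst (asm) measurable_cong) auto
qed

text \<open>Shifting \<open>h\<close> by \<open>C\<close> turns the double integral into one of
  nonnegative functions, whose finiteness yields integrability under almost every
  \<open>K x\<close>. Strict positivity of \<open>v\<close> is what passes from
  \<open>v x * I x\<close> finite to \<open>I x\<close> finite.\<close>

lemma kernel_integral:
  fixes K :: "'a \<Rightarrow> 'b measure" and v :: "'a \<Rightarrow> real" and h :: "'b \<Rightarrow> real"
  assumes K: "K \<in> M \<rightarrow>\<^sub>M prob_algebra N" and h[measurable]: "h \<in> borel_measurable N"
    and hC: "\<And>y. - C \<le> h y"
    and v: "integrable M v" "\<And>x. 0 < v x"
    and fin: "(\<integral>\<^sup>+x. ennreal (v x) * (\<integral>\<^sup>+y. ennreal (h y + C) \<partial>K x) \<partial>M) < \<infinity>"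
  shows "AE x in M. integrable (K x) h"
    and "integrable M (\<lambda>x. v x * (\<integral>y. h y \<partial>K x))"
    and "(\<integral>x. v x * (\<integral>y. h y \<partial>K x) \<partial>M) =
      enn2real (\<integral>\<^sup>+x. ennreal (v x) * (\<integral>\<^sup>+y. ennreal (h y + C) \<partial>K x) \<partial>M) - C * (\<integral>x. v x \<partial>M)"
proof -
  have [measurable]: "v \<in> borel_measurable M" using v by auto
  have Ks[measurable]: "K \<in> M \<rightarrow>\<^sub>M subprob_algebra N" using K by (rule measurable_prob_algebraD)
  have sK: "sets (K x) = sets N" and pK: "prob_space (K x)" if "x \<in> space M" for x
    using measurable_space[OF K that] by (auto simp: space_prob_algebra)
  have hC': "0 \<le> h y + C" for y using hC[of y] by simp
  define I where "I x = (\<integral>\<^sup>+y. ennreal (h y + C) \<partial>K x)" for x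
  have I[measurable]: "I \<in> borel_measurable M"
    unfolding I_def by (rule measurable_compose[OF Ks nn_integral_measurable_subprob_algebra]) simp
  have fin: "(\<integral>\<^sup>+x. ennreal (v x) * I x \<partial>M) < \<infinity>" using fin by (simp add: I_def)
  then have "AE x in M. ennreal (v x) * I x \<noteq> \<infinity>"
    by (intro nn_integral_noteq_infinite) auto
  then have AEI: "AE x in M. I x < \<infinity>"
  proof eventually_elim
    case (elim x)
    then show ?case using v(2)[of x] by (auto simp: ennreal_mult_eq_top_iff less_top)
  qed
  have *: "integrable (K x) h \<and> v x * (\<integral>y. h y \<partial>K x) = v x * enn2real (I x) - C * v x"
    if x: "x \<in> space M" "I x < \<infinity>" for x
  proof -
    interpret K: prob_space "K x" by (rule pK) fact
    have [measurable]: "h \<in> borel_measurable (K x)"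
      using h unfolding measurable_cong_sets[OF sK[OF x(1)] refl] .
    have i: "integrable (K x) (\<lambda>y. h y + C)"
      using x hC' by (intro integrableI_nonneg) (auto simp: I_def)
    then have "integrable (K x) (\<lambda>y. (h y + C) - C)" by (intro Bochner_Integration.integrable_diff) auto
    then have ih: "integrable (K x) h" by simp
    have "(\<integral>y. h y + C \<partial>K x) = enn2real (I x)"
      unfolding I_def by (rule integral_eq_nn_integral) (auto simp: hC')
    moreover have "(\<integral>y. h y + C \<partial>K x) = (\<integral>y. h y \<partial>K x) + C"
      using ih by (simp add: K.prob_space)
    ultimately show ?thesis using ih by (simp add: algebra_simps)
  qed
  show "AE x in M. integrable (K x) h" using AEI AE_space by eventually_elim (use * in auto)
  have AEeq: "AE x in M. v x * (\<integral>y. h y \<partial>K x) = v x * enn2real (I x) - C * v x"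
    using AEI AE_space by eventually_elim (use * in auto)
  have mI: "(\<lambda>x. \<integral>y. h y \<partial>K x) \<in> borel_measurable M"
    by (rule measurable_compose[OF Ks integral_measurable_subprob_algebra]) simp
  have eqn: "(\<integral>\<^sup>+x. ennreal (v x * enn2real (I x)) \<partial>M) = (\<integral>\<^sup>+x. ennreal (v x) * I x \<partial>M)"
    using AEI v(2) by (intro nn_integral_cong_AE)
      (auto simp: ennreal_mult' less_imp_le)
  have i1: "integrable M (\<lambda>x. v x * enn2real (I x))"
    by (rule integrableI_nonneg) (use eqn fin v(2) in \<open>auto simp: less_imp_le\<close>)
  have i2: "integrable M (\<lambda>x. v x * enn2real (I x) - C * v x)" using i1 v by auto
  show "integrable M (\<lambda>x. v x * (\<integral>y. h y \<partial>K x))"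
    by (subst integrable_cong_AE[OF _ _ AEeq]) (use mI i2 in auto)
  have "(\<integral>x. v x * (\<integral>y. h y \<partial>K x) \<partial>M) = (\<integral>x. v x * enn2real (I x) - C * v x \<partial>M)"
    by (rule integral_cong_AE[OF _ _ AEeq]) (use mI in auto)
  also have "\<dots> = (\<integral>x. v x * enn2real (I x) \<partial>M) - C * (\<integral>x. v x \<partial>M)" using i1 v by simp
  also have "(\<integral>x. v x * enn2real (I x) \<partial>M) = enn2real (\<integral>\<^sup>+x. ennreal (v x) * I x \<partial>M)"
    unfolding eqn[symmetric] by (rule integral_eq_nn_integral) (use v(2) in \<open>auto simp: less_imp_le\<close>)
  finally show "(\<integral>x. v x * (\<integral>y. h y \<partial>K x) \<partial>M) =
      enn2real (\<integral>\<^sup>+x. ennreal (v x) * (\<integral>\<^sup>+y. ennreal (h y + C) \<partial>K x) \<partial>M) - C * (\<integral>x. v x \<partial>M)"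
    by (simp add: I_def)
qed

subsection \<open>The Poissonized flow of densities\<close>

text \<open>Sum and integral are exchanged by monotone convergence, without integrability of
  \<open>f\<close>. The weights \<open>w\<close> are general so that both a sequence of densities
  and its shift can be inserted.\<close>

lemma nn_integral_weighted_series:
  fixes w :: "nat \<Rightarrow> 'a \<Rightarrow> real"
  assumes t: "0 \<le> t" and f[measurable]: "f \<in> borel_measurable M"
    and w[measurable]: "\<And>k. w k \<in> borel_measurable M" and nn: "\<And>k x. 0 \<le> w k x"
    and s: "\<And>x. summable (\<lambda>k. w k x / fact k * t ^ k)"
  shows "(\<integral>\<^sup>+x. ennreal (exp (- t) * (\<Sum>k. w k x / fact k * t ^ k)) * f x \<partial>M) =
    (\<Sum>k. ennreal (exp (- t) * t ^ k / fact k) * (\<integral>\<^sup>+x. ennreal (w k x) * f x \<partial>M))"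
proof -
  have "ennreal (exp (- t) * (\<Sum>k. w k x / fact k * t ^ k)) * f x =
      (\<Sum>k. ennreal (exp (- t) * t ^ k / fact k) * (ennreal (w k x) * f x))" for x
  proof -
    have "ennreal (\<Sum>k. w k x / fact k * t ^ k) = (\<Sum>k. ennreal (w k x / fact k * t ^ k))"
      using nn t by (intro suminf_ennreal2[symmetric] s) auto
    then have "ennreal (exp (- t) * (\<Sum>k. w k x / fact k * t ^ k)) * f x =
        (\<Sum>k. ennreal (exp (- t)) * ennreal (w k x / fact k * t ^ k) * f x)"
      by (simp add: ennreal_mult' ennreal_suminf_cmult ennreal_suminf_multc)
    also have "\<dots> = (\<Sum>k. ennreal (exp (- t) * t ^ k / fact k) * (ennreal (w k x) * f x))"
    proof (intro suminf_cong)
      fix k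
      have "exp (- t) * (w k x / fact k * t ^ k) = exp (- t) * t ^ k / fact k * w k x" by simp
      then have "ennreal (exp (- t)) * ennreal (w k x / fact k * t ^ k) =
          ennreal (exp (- t) * t ^ k / fact k) * ennreal (w k x)"
        using nn[of k x] t by (metis ennreal_mult' exp_ge_zero divide_nonneg_pos fact_gt_zero
            mult_nonneg_nonneg zero_le_power)
      then show "ennreal (exp (- t)) * ennreal (w k x / fact k * t ^ k) * f x =
          ennreal (exp (- t) * t ^ k / fact k) * (ennreal (w k x) * f x)"
        by (simp only: mult.assoc)
    qed
    finally show ?thesis .
  qed
  then have "(\<integral>\<^sup>+x. ennreal (exp (- t) * (\<Sum>k. w k x / fact k * t ^ k)) * f x \<partial>M) =
    (\<integral>\<^sup>+x. (\<Sum>k. ennreal (exp (- t) * t ^ k / fact k) * (ennreal (w k x) * f x)) \<partial>M)" by simp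
  also have "\<dots> = (\<Sum>k. \<integral>\<^sup>+x. ennreal (exp (- t) * t ^ k / fact k) * (ennreal (w k x) * f x) \<partial>M)"
    by (rule nn_integral_suminf) auto
  also have "\<dots> = (\<Sum>k. ennreal (exp (- t) * t ^ k / fact k) * (\<integral>\<^sup>+x. ennreal (w k x) * f x \<partial>M))"
    by (intro suminf_cong nn_integral_cmult) auto
  finally show ?thesis .
qed

text \<open>\<^term>\<open>u k\<close> is the density of the law of the chain after \<open>k\<close> steps; the summability and the lower
  bound are required at every point, which is harmless by changing the densities on a null set.\<close>

locale poisson_density_flow = prob_space \<pi>
  for \<pi> :: "'a::topological_space measure" +
  fixes P Q :: "'a \<Rightarrow> 'a measure" and u :: "nat \<Rightarrow> 'a \<Rightarrow> real" and c :: real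
  assumes sets_pi[measurable_cong]: "sets \<pi> = sets borel"
    and P: "P \<in> borel \<rightarrow>\<^sub>M prob_algebra borel"
    and Q: "Q \<in> borel \<rightarrow>\<^sub>M prob_algebra borel"
    and invariant: "bind \<pi> P = \<pi>"
    and u_meas[measurable]: "\<And>k. u k \<in> borel_measurable borel"
    and u_nonneg: "\<And>k x. 0 \<le> u k x"
    and c_pos: "0 < c" and u_ge: "\<And>x. c \<le> u 0 x"
    and u_summable: "\<And>(t::real) x. summable (\<lambda>k. u k x / fact k * t ^ k)"
    and u_step: "\<And>k. density \<pi> (u (Suc k)) = bind (density \<pi> (u k)) Q"
    and u_prob: "prob_space (density \<pi> (u 0))"
    and entropy_0: "integrable \<pi> (\<lambda>x. u 0 x * ln (u 0 x))"
    and entropy_step: "\<And>t. 0 \<le> t \<Longrightarrow> integrable \<pi> (\<lambda>x.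
      exp (- t) * (\<Sum>k. u (Suc k) x / fact k * t ^ k) *
      ln (exp (- t) * (\<Sum>k. u (Suc k) x / fact k * t ^ k)))"
begin

text \<open>An everywhere convergent power series in \<open>t\<close> times
  \<open>exp (- t)\<close>. It makes sense for negative \<open>t\<close> as well, so two-sided
  derivatives are available at 0.\<close>

definition v :: "real \<Rightarrow> 'a \<Rightarrow> real" where
  "v t x = exp (- t) * (\<Sum>k. u k x / fact k * t ^ k)"

text \<open>The shifted series has two roles: it is the density of \<open>v t\<close> pushed through
  \<open>Q\<close> (\<open>nn_integral_q\<close>) and, up to the factor \<open>exp (- t)\<close>,
  the termwise time derivative of the series in \<open>v\<close> (\<open>v_deriv\<close>).\<close>

definition q :: "real \<Rightarrow> 'a \<Rightarrow> real" where
  "q t x = exp (- t) * (\<Sum>k. u (Suc k) x / fact k * t ^ k)"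

text \<open>Division by \<open>fact k\<close> makes formal differentiation of the generating series
  a pure index shift.\<close>

lemma diffs_u: "diffs (\<lambda>k. u k x / fact k) = (\<lambda>k. u (Suc k) x / fact k)"
  by (auto simp: diffs_def fun_eq_iff field_simps simp del: of_nat_Suc)

lemma u_Suc_summable: "summable (\<lambda>k. u (Suc k) x / fact k * t ^ k)"
  using termdiff_converges_all[of "\<lambda>k. u k x / fact k" t] u_summable by (simp add: diffs_u)

lemma v_measurable[measurable]:
  "(\<lambda>(t, x). v t x) \<in> borel_measurable (borel \<Otimes>\<^sub>M borel)"
  "(\<lambda>(t, x). q t x) \<in> borel_measurable (borel \<Otimes>\<^sub>M borel)"
  unfolding v_def q_def by measurable

lemma v_measurable'[measurable (raw)]:
  assumes "f \<in> borel_measurable M" "g \<in> borel_measurable M"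
  shows "(\<lambda>x. v (f x) (g x)) \<in> borel_measurable M" "(\<lambda>x. q (f x) (g x)) \<in> borel_measurable M"
  using measurable_compose[OF measurable_Pair[OF assms] v_measurable(1)]
    measurable_compose[OF measurable_Pair[OF assms] v_measurable(2)] by auto

text \<open>The forward equation: \<open>q\<close> comes from differentiating the series,
  \<open>- v\<close> from the factor \<open>exp (- t)\<close>.\<close>

lemma v_deriv: "((\<lambda>s. v s x) has_real_derivative q t x - v t x) (at t)"
proof -
  have "((\<lambda>t. \<Sum>k. u k x / fact k * t ^ k) has_real_derivative (\<Sum>k. u (Suc k) x / fact k * t ^ k)) (at t)"
    using termdiffs_strong_converges_everywhere[OF u_summable, of x t] by (simp add: diffs_u)
  then show ?thesis unfolding v_def q_def
    by (auto intro!: derivative_eq_intros)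
qed

lemma q_isCont: "isCont (\<lambda>s. q s x) t"
proof -
  have "((\<lambda>t. \<Sum>k. u (Suc k) x / fact k * t ^ k) has_real_derivative
      (\<Sum>k. diffs (\<lambda>k. u (Suc k) x / fact k) k * t ^ k)) (at t)"
    by (rule termdiffs_strong_converges_everywhere[OF u_Suc_summable])
  then show ?thesis unfolding q_def by (intro continuous_intros) (rule DERIV_isCont)
qed

text \<open>Only the term \<open>k = 0\<close>, no jump so far, is kept. The lower bound on the
  initial density thus survives, damped by \<open>exp (- t)\<close>, and keeps
  \<open>ln (v t x)\<close> bounded below.\<close>

lemma v_ge:
  assumes "0 \<le> t"
  shows "exp (- t) * c \<le> v t x"
proof -
  have "u 0 x \<le> (\<Sum>k. u k x / fact k * t ^ k)"
    using sum_le_suminf[OF u_summable, of "{0}" x t] assms u_nonneg by simp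
  then show ?thesis unfolding v_def using u_ge[of x] by (intro mult_left_mono) auto
qed

lemma v_pos: "0 \<le> t \<Longrightarrow> 0 < v t x"
  using v_ge[of t x] c_pos by (smt (verit) exp_gt_zero mult_pos_pos)

lemma q_nonneg: "0 \<le> t \<Longrightarrow> 0 \<le> q t x"
  unfolding q_def using u_nonneg by (intro mult_nonneg_nonneg suminf_nonneg u_Suc_summable) auto

text \<open>The power series have nonnegative coefficients, so they increase in time, and the
  exponential prefactors cost at most \<open>exp t\<close>. The functions at the final time
  therefore dominate a whole time interval.\<close>

lemma v_q_le:
  assumes "0 \<le> s" "s \<le> t"
  shows "v s x \<le> exp t * v t x" "q s x \<le> exp t * q t x"
proof -
  have *: "exp (- s) * a \<le> exp t * (exp (- t) * b)" if "a \<le> b" "0 \<le> a" for a b :: real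
  proof -
    have "exp (- s) * a \<le> a" using that assms by (intro mult_left_le_one_le) auto
    then show ?thesis using that by (simp add: exp_minus mult.assoc[symmetric])
  qed
  show "v s x \<le> exp t * v t x" unfolding v_def using assms u_nonneg
    by (intro * suminf_le suminf_nonneg u_summable mult_left_mono power_mono) auto
  show "q s x \<le> exp t * q t x" unfolding q_def using assms u_nonneg
    by (intro * suminf_le suminf_nonneg u_Suc_summable mult_left_mono power_mono) auto
qed

text \<open>The entropy of \<^term>\<open>v t\<close> is not assumed finite for \<open>t > 0\<close>; this bound derives it from the
  hypotheses on \<^term>\<open>u 0\<close> and \<^term>\<open>q t\<close>.\<close>

lemma v_le_q:
  assumes "0 \<le> t"
  shows "v t x \<le> u 0 x + t * q t x"
proof -
  have s: "summable (\<lambda>k. u (Suc k) x / fact (Suc k) * t ^ Suc k)"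
    using u_summable[of x t] by (subst summable_Suc_iff)
  have "(\<Sum>k. u k x / fact k * t ^ k) = u 0 x + (\<Sum>k. u (Suc k) x / fact (Suc k) * t ^ Suc k)"
    using suminf_split_head[OF u_summable, of x t] by simp
  also have "(\<Sum>k. u (Suc k) x / fact (Suc k) * t ^ Suc k) \<le> (\<Sum>k. t * (u (Suc k) x / fact k * t ^ k))"
  proof (rule suminf_le[OF _ s])
    show "summable (\<lambda>k. t * (u (Suc k) x / fact k * t ^ k))"
      by (intro summable_mult u_Suc_summable)
    show "u (Suc k) x / fact (Suc k) * t ^ Suc k \<le> t * (u (Suc k) x / fact k * t ^ k)" for k
    proof -
      have "u (Suc k) x / fact (Suc k) \<le> u (Suc k) x / fact k"
        using u_nonneg by (intro divide_left_mono fact_mono) auto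
      then have "u (Suc k) x / fact (Suc k) * t ^ Suc k \<le> u (Suc k) x / fact k * t ^ Suc k"
        using assms by (intro mult_right_mono) auto
      then show ?thesis by (simp add: algebra_simps)
    qed
  qed
  also have "\<dots> = t * (\<Sum>k. u (Suc k) x / fact k * t ^ k)"
    by (intro suminf_mult u_Suc_summable)
  finally have "v t x \<le> exp (- t) * (u 0 x + t * (\<Sum>k. u (Suc k) x / fact k * t ^ k))"
    unfolding v_def by (intro mult_left_mono) auto
  also have "\<dots> = exp (- t) * u 0 x + t * q t x" by (simp add: q_def algebra_simps)
  also have "exp (- t) * u 0 x \<le> u 0 x" using assms u_nonneg[of 0 x] by (intro mult_left_le_one_le) auto
  finally show ?thesis by simp
qed

section \<open>Duality, mass and entropy class of the flow\<close>

lemma borel_measurable_pi: "f \<in> borel_measurable borel \<Longrightarrow> f \<in> borel_measurable \<pi>"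
  by (simp add: measurable_cong_sets[OF sets_pi refl])

lemma Q_sub[measurable]: "Q \<in> borel \<rightarrow>\<^sub>M subprob_algebra borel"
  and P_sub[measurable]: "P \<in> borel \<rightarrow>\<^sub>M subprob_algebra borel"
  using Q P by (auto intro: measurable_prob_algebraD)

lemma Q_sub'[measurable]: "Q \<in> \<pi> \<rightarrow>\<^sub>M subprob_algebra borel"
  and P_sub'[measurable]: "P \<in> \<pi> \<rightarrow>\<^sub>M subprob_algebra borel"
  and P': "P \<in> \<pi> \<rightarrow>\<^sub>M prob_algebra borel" and Q': "Q \<in> \<pi> \<rightarrow>\<^sub>M prob_algebra borel"
  using P Q Q_sub P_sub unfolding measurable_cong_sets[OF sets_pi refl] by auto

lemma nn_integral_P:
  assumes [measurable]: "f \<in> borel_measurable borel"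
  shows "(\<integral>\<^sup>+x. (\<integral>\<^sup>+y. f y \<partial>P x) \<partial>\<pi>) = (\<integral>\<^sup>+x. f x \<partial>\<pi>)"
  by (subst (2) invariant[symmetric], subst nn_integral_bind[OF assms P_sub']) simp

lemma nn_integral_u:
  assumes f[measurable]: "f \<in> borel_measurable borel"
  shows "(\<integral>\<^sup>+x. ennreal (u (Suc k) x) * f x \<partial>\<pi>) = (\<integral>\<^sup>+x. ennreal (u k x) * (\<integral>\<^sup>+y. f y \<partial>Q x) \<partial>\<pi>)"
proof -
  have Qd: "Q \<in> density \<pi> (u k) \<rightarrow>\<^sub>M subprob_algebra borel"
    using Q_sub' by (simp add: measurable_density_eq1)
  have "(\<integral>\<^sup>+x. ennreal (u (Suc k) x) * f x \<partial>\<pi>) = (\<integral>\<^sup>+x. f x \<partial>density \<pi> (u (Suc k)))"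
    by (subst nn_integral_density) auto
  also have "\<dots> = (\<integral>\<^sup>+x. (\<integral>\<^sup>+y. f y \<partial>Q x) \<partial>density \<pi> (u k))"
    unfolding u_step by (rule nn_integral_bind[OF f Qd])
  also have "\<dots> = (\<integral>\<^sup>+x. ennreal (u k x) * (\<integral>\<^sup>+y. f y \<partial>Q x) \<partial>\<pi>)"
    by (subst nn_integral_density)
       (auto intro!: measurable_compose[OF Q_sub' nn_integral_measurable_subprob_algebra])
  finally show ?thesis .
qed

lemma nn_integral_v:
  assumes t: "0 \<le> t" and f: "f \<in> borel_measurable borel"
  shows "(\<integral>\<^sup>+x. ennreal (v t x) * f x \<partial>\<pi>) =
    (\<Sum>k. ennreal (exp (- t) * t ^ k / fact k) * (\<integral>\<^sup>+x. ennreal (u k x) * f x \<partial>\<pi>))"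
  unfolding v_def by (intro nn_integral_weighted_series t borel_measurable_pi f u_meas u_nonneg u_summable)

text \<open>\<open>nn_integral_u\<close> moves \<open>Q\<close> onto \<open>f\<close> in each term
  of the mixture. This duality identifies \<open>q t\<close> as the image of \<open>v t\<close>
  under the dual of \<open>Q\<close>.\<close>

lemma nn_integral_q:
  assumes t: "0 \<le> t" and f[measurable]: "f \<in> borel_measurable borel"
  shows "(\<integral>\<^sup>+x. ennreal (q t x) * f x \<partial>\<pi>) = (\<integral>\<^sup>+x. ennreal (v t x) * (\<integral>\<^sup>+y. f y \<partial>Q x) \<partial>\<pi>)"
proof -
  have m: "(\<lambda>x. \<integral>\<^sup>+y. f y \<partial>Q x) \<in> borel_measurable borel"
    by (rule measurable_compose[OF Q_sub nn_integral_measurable_subprob_algebra]) simp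
  have "(\<integral>\<^sup>+x. ennreal (q t x) * f x \<partial>\<pi>) =
      (\<Sum>k. ennreal (exp (- t) * t ^ k / fact k) * (\<integral>\<^sup>+x. ennreal (u (Suc k) x) * f x \<partial>\<pi>))"
    unfolding q_def by (intro nn_integral_weighted_series t borel_measurable_pi f u_meas u_nonneg u_Suc_summable)
  also have "\<dots> = (\<integral>\<^sup>+x. ennreal (v t x) * (\<integral>\<^sup>+y. f y \<partial>Q x) \<partial>\<pi>)"
    unfolding nn_integral_v[OF t m] by (simp add: nn_integral_u)
  finally show ?thesis .
qed

lemma kernel_space_1: "emeasure (Q x) (space (Q x)) = 1" "emeasure (P x) (space (P x)) = 1"
  using measurable_space[OF Q, of x] measurable_space[OF P, of x]
  by (auto simp: space_prob_algebra prob_space.emeasure_space_1)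

lemma poisson_weights: "0 \<le> t \<Longrightarrow> (\<Sum>k. ennreal (exp (- t) * t ^ k / fact k)) = 1"
proof -
  assume t: "0 \<le> t"
  have "(\<lambda>k. exp (- t) * (t ^ k / fact k)) sums (exp (- t) * exp t)"
    using exp_converges[of t] by (intro sums_mult) (simp add: divide_inverse_commute)
  then have "(\<lambda>k. exp (- t) * t ^ k / fact k) sums 1" by (simp add: exp_minus)
  then have "(\<Sum>k. ennreal (exp (- t) * t ^ k / fact k)) = ennreal 1"
    using t by (intro suminf_ennreal_eq) auto
  then show ?thesis by simp
qed

lemma nn_integral_u_1: "(\<integral>\<^sup>+x. ennreal (u k x) \<partial>\<pi>) = 1"
proof (induction k)
  case 0
  interpret U: prob_space "density \<pi> (u 0)" by (rule u_prob)
  have "(\<integral>\<^sup>+x. 1 \<partial>density \<pi> (u 0)) = 1"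
    using U.emeasure_space_1 by simp
  then show ?case by (subst (asm) nn_integral_density) auto
next
  case (Suc k)
  then show ?case using nn_integral_u[of "\<lambda>_. 1" k] by (simp add: kernel_space_1)
qed

lemma nn_integral_v_1:
  assumes "0 \<le> t" shows "(\<integral>\<^sup>+x. ennreal (v t x) \<partial>\<pi>) = 1"
proof -
  have "(\<integral>\<^sup>+x. ennreal (v t x) * 1 \<partial>\<pi>) = (\<Sum>k. ennreal (exp (- t) * t ^ k / fact k) * 1)"
    using assms by (subst nn_integral_v) (simp_all add: nn_integral_u_1 del: suminf_ennreal2)
  then show ?thesis unfolding mult_1_right poisson_weights[OF assms] .
qed

lemma nn_integral_q_1:
  assumes "0 \<le> t" shows "(\<integral>\<^sup>+x. ennreal (q t x) \<partial>\<pi>) = 1"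
  using nn_integral_q[OF assms, of "\<lambda>_. 1"] by (simp add: kernel_space_1 nn_integral_v_1[OF assms])

lemma v_integrable:
  assumes "0 \<le> t" shows "integrable \<pi> (v t)"
proof (rule integrableI_nonneg)
  show "AE x in \<pi>. 0 \<le> v t x" using v_pos[OF assms] by (simp add: less_imp_le)
qed (simp_all add: nn_integral_v_1[OF assms])

lemma q_integrable:
  assumes "0 \<le> t" shows "integrable \<pi> (q t)"
proof (rule integrableI_nonneg)
  show "AE x in \<pi>. 0 \<le> q t x" using q_nonneg[OF assms] by simp
qed (simp_all add: nn_integral_q_1[OF assms])

lemma integral_v:
  assumes "0 \<le> t" shows "(\<integral>x. v t x \<partial>\<pi>) = 1"
proof -
  have "AE x in \<pi>. 0 \<le> v t x" using v_pos[OF assms] by (simp add: less_imp_le)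
  then show ?thesis by (subst integral_eq_nn_integral) (simp_all add: nn_integral_v_1[OF assms])
qed

lemma integral_q:
  assumes "0 \<le> t" shows "(\<integral>x. q t x \<partial>\<pi>) = 1"
proof -
  have "AE x in \<pi>. 0 \<le> q t x" using q_nonneg[OF assms] by simp
  then show ?thesis by (subst integral_eq_nn_integral) (simp_all add: nn_integral_q_1[OF assms])
qed

lemma v_0: "v 0 x = u 0 x"
proof -
  have "(\<Sum>k. a k * 0 ^ k) = a 0" for a :: "nat \<Rightarrow> real" by simp
  from this[of "\<lambda>k. u k x / fact k"] show ?thesis by (simp add: v_def)
qed

text \<open>The factor \<open>exp r\<close> accommodates the loss in \<open>v_q_le\<close>; every
  positive constant has this form.\<close>

lemma q_LlogL:
  assumes "0 \<le> t" shows "(\<lambda>x. exp r * q t x) \<in> LlogL \<pi>"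
proof (rule LlogL_scale)
  show "q t \<in> LlogL \<pi>"
    unfolding LlogL_iff[of "q t", OF q_integrable[OF assms] q_nonneg[OF assms]]
    using entropy_step[OF assms] unfolding q_def[symmetric] .
qed simp

lemma v_LlogL:
  assumes "0 \<le> t" shows "v t \<in> LlogL \<pi>"
proof -
  have "v 0 = u 0" by (simp add: v_0 fun_eq_iff)
  then have i: "integrable \<pi> (u 0)" using v_integrable[of 0] by simp
  have u: "u 0 \<in> LlogL \<pi>" unfolding LlogL_iff[of "u 0", OF i u_nonneg] by (rule entropy_0)
  show ?thesis
  proof (cases "t = 0")
    case True
    then show ?thesis using u \<open>v 0 = u 0\<close> by simp
  next
    case False
    \<comment> \<open>The multiple \<open>t\<close> of \<open>q t\<close> is written as
      \<open>exp (ln t)\<close>, which needs \<open>t > 0\<close>; hence the separate case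
      \<open>t = 0\<close>.\<close>
    then have t: "exp (ln t) = t" using assms by simp
    have "(\<lambda>x. t * q t x) \<in> LlogL \<pi>" using q_LlogL[OF assms, of "ln t"] unfolding t .
    from LlogL_add[OF u this] show ?thesis
      by (rule LlogL_mono) (use assms v_le_q v_pos[of t] in \<open>auto simp: less_imp_le\<close>)
  qed
qed

lemma v_LlogL': "0 \<le> t \<Longrightarrow> (\<lambda>x. exp r * v t x) \<in> LlogL \<pi>"
  by (intro LlogL_scale v_LlogL) auto

end

subsection \<open>Dissipation of entropy\<close>

context poisson_density_flow
begin

lemma ln_v_ge: "0 \<le> t \<Longrightarrow> - (t - ln c) \<le> ln (v t x)"
  using ln_mono[OF v_ge[of t x]] c_pos by (simp add: ln_mult)

text \<open>A majorant of \<open>\<bar>ln (v t x)\<bar>\<close> for all times in [0, T] at once: the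
  first summand controls large values through \<open>v_q_le\<close>, while \<open>T\<close> and
  \<open>\<bar>ln c\<bar>\<close> control small values through \<open>ln_v_ge\<close>.\<close>

definition H :: "real \<Rightarrow> 'a \<Rightarrow> real" where
  "H T x = max 0 (ln (exp T * v T x)) + T + \<bar>ln c\<bar>"

lemma H_nonneg: "0 \<le> T \<Longrightarrow> 0 \<le> H T x"
  by (simp add: H_def)

lemma abs_ln_v_le:
  assumes "0 \<le> t" "t \<le> T"
  shows "\<bar>ln (v t x)\<bar> \<le> H T x"
proof -
  have "ln (v t x) \<le> ln (exp T * v T x)"
    using v_q_le(1)[OF assms, of x] v_pos[OF assms(1), of x] by (intro ln_mono) auto
  moreover have "- (t - ln c) \<le> ln (v t x)" using assms by (intro ln_v_ge)
  ultimately show ?thesis using assms unfolding H_def by linarith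
qed

lemma H_measurable[measurable]: "H T \<in> borel_measurable borel"
  unfolding H_def by measurable

lemma v_H_integrable:
  assumes "0 \<le> T"
  shows "integrable \<pi> (\<lambda>x. exp T * v T x * H T x)"
proof -
  have "integrable \<pi> (\<lambda>x. (exp T * v T x) * max 0 (ln (exp T * v T x)) + exp T * v T x * (T + \<bar>ln c\<bar>))"
    using LlogL_mult_ln[OF v_LlogL'[OF assms, of T] v_LlogL'[OF assms, of T]] v_integrable[OF assms]
    by (intro Bochner_Integration.integrable_add) auto
  then show ?thesis by (simp add: H_def algebra_simps)
qed

text \<open>Here \<open>q\<close> meets the logarithm of a different density; the Young inequality
  behind \<open>LlogL_mult_ln\<close> handles this mixed product.\<close>

lemma q_H_integrable:
  assumes "0 \<le> T"
  shows "integrable \<pi> (\<lambda>x. exp T * q T x * H T x)"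
proof -
  have "integrable \<pi> (\<lambda>x. (exp T * q T x) * max 0 (ln (exp T * v T x)) + exp T * q T x * (T + \<bar>ln c\<bar>))"
    using LlogL_mult_ln[OF v_LlogL'[OF assms, of T] q_LlogL[OF assms, of T]] q_integrable[OF assms]
    by (intro Bochner_Integration.integrable_add) auto
  then show ?thesis by (simp add: H_def algebra_simps)
qed

lemma q_ln_v_le:
  assumes "0 \<le> t" "t \<le> T"
  shows "\<bar>q t x * ln (v t x)\<bar> \<le> exp T * q T x * H T x"
    and "\<bar>v t x * ln (v t x)\<bar> \<le> exp T * v T x * H T x"
  using mult_mono[OF v_q_le(2)[OF assms] abs_ln_v_le[OF assms], of x x]
    mult_mono[OF v_q_le(1)[OF assms] abs_ln_v_le[OF assms], of x x]
    q_nonneg[of t x] q_nonneg[of T x] v_pos[of t x] v_pos[of T x] assms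
  by (simp_all add: abs_mult)

lemma q_ln_v_integrable:
  assumes "0 \<le> t"
  shows "integrable \<pi> (\<lambda>x. q t x * ln (v t x))" "integrable \<pi> (\<lambda>x. v t x * ln (v t x))"
proof -
  show "integrable \<pi> (\<lambda>x. q t x * ln (v t x))"
    using q_ln_v_le(1)[OF assms order_refl]
    by (intro Bochner_Integration.integrable_bound[OF q_H_integrable[OF assms]] AE_I2)
      (auto intro: order_trans[OF _ abs_ge_self])
  show "integrable \<pi> (\<lambda>x. v t x * ln (v t x))"
    using q_ln_v_le(2)[OF assms order_refl]
    by (intro Bochner_Integration.integrable_bound[OF v_H_integrable[OF assms]] AE_I2)
      (auto intro: order_trans[OF _ abs_ge_self])
qed

text \<open>The shift \<open>?C\<close> makes the logarithm nonnegative, so duality in the form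
  \<open>nn_integral_q\<close> applies. The shift cancels afterwards because \<open>v t\<close> and
  \<open>q t\<close> both have mass 1.\<close>

lemma Q_ln_v:
  assumes t: "0 \<le> t"
  shows "AE x in \<pi>. integrable (Q x) (\<lambda>y. ln (v t y))"
    and "integrable \<pi> (\<lambda>x. v t x * (\<integral>y. ln (v t y) \<partial>Q x))"
    and "(\<integral>x. v t x * (\<integral>y. ln (v t y) \<partial>Q x) \<partial>\<pi>) = (\<integral>x. q t x * ln (v t x) \<partial>\<pi>)"
proof -
  let ?C = "t - ln c"
  have nn: "0 \<le> q t x * (ln (v t x) + ?C)" for x
    using q_nonneg[OF t] ln_v_ge[OF t, of x] by (intro mult_nonneg_nonneg) auto
  have i: "integrable \<pi> (\<lambda>x. q t x * (ln (v t x) + ?C))"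
    using q_ln_v_integrable(1)[OF t] q_integrable[OF t] by (simp add: distrib_left)
  have "(\<integral>\<^sup>+x. ennreal (v t x) * (\<integral>\<^sup>+y. ennreal (ln (v t y) + ?C) \<partial>Q x) \<partial>\<pi>) =
      (\<integral>\<^sup>+x. ennreal (q t x) * ennreal (ln (v t x) + ?C) \<partial>\<pi>)"
    by (rule nn_integral_q[symmetric, OF t]) measurable
  also have "\<dots> = (\<integral>\<^sup>+x. ennreal (q t x * (ln (v t x) + ?C)) \<partial>\<pi>)"
    using q_nonneg[OF t] by (simp add: ennreal_mult')
  also have "\<dots> = ennreal (\<integral>x. q t x * (ln (v t x) + ?C) \<partial>\<pi>)"
    using nn by (intro nn_integral_eq_integral[OF i]) auto
  finally have eq: "(\<integral>\<^sup>+x. ennreal (v t x) * (\<integral>\<^sup>+y. ennreal (ln (v t y) + ?C) \<partial>Q x) \<partial>\<pi>) =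
    ennreal (\<integral>x. q t x * (ln (v t x) + ?C) \<partial>\<pi>)" .
  have m: "(\<lambda>y. ln (v t y)) \<in> borel_measurable borel" by measurable
  note k = kernel_integral[OF Q' m ln_v_ge[OF t] v_integrable[OF t] v_pos[OF t], unfolded eq]
  show "AE x in \<pi>. integrable (Q x) (\<lambda>y. ln (v t y))"
    and "integrable \<pi> (\<lambda>x. v t x * (\<integral>y. ln (v t y) \<partial>Q x))"
    using k(1,2) by auto
  have "(\<integral>x. v t x * (\<integral>y. ln (v t y) \<partial>Q x) \<partial>\<pi>) = (\<integral>x. q t x * (ln (v t x) + ?C) \<partial>\<pi>) - ?C * (\<integral>x. v t x \<partial>\<pi>)"
    using k(3) integral_nonneg_AE[of "\<lambda>x. q t x * (ln (v t x) + ?C)" \<pi>] nn by simp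
  also have "(\<integral>x. q t x * (ln (v t x) + ?C) \<partial>\<pi>) = (\<integral>x. q t x * ln (v t x) \<partial>\<pi>) + ?C * (\<integral>x. q t x \<partial>\<pi>)"
    using q_ln_v_integrable(1)[OF t] q_integrable[OF t] by (simp add: distrib_left)
  finally show "(\<integral>x. v t x * (\<integral>y. ln (v t y) \<partial>Q x) \<partial>\<pi>) = (\<integral>x. q t x * ln (v t x) \<partial>\<pi>)"
    by (simp add: integral_v[OF t] integral_q[OF t])
qed

text \<open>Instead of a dual density for \<open>P\<close>, Young's inequality separates
  \<open>x\<close> from \<open>y\<close> in \<open>v t x * ln (v t y)\<close>, and invariance of
  \<pi> integrates the remaining \<open>v t y\<close> to 1.\<close>

lemma P_ln_v:
  assumes t: "0 \<le> t"
  shows "AE x in \<pi>. integrable (P x) (\<lambda>y. ln (v t y))"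
    and "integrable \<pi> (\<lambda>x. v t x * (\<integral>y. ln (v t y) \<partial>P x))"
proof -
  \<comment> \<open>\<open>?C\<close> is the shift that makes \<open>ln (v t y) + ?C\<close>
    nonnegative; \<open>?D\<close> is a nonnegative majorant of \<open>?C\<close>, which keeps
    \<open>?g\<close> nonnegative.\<close>
  let ?C = "t - ln c" and ?D = "t + \<bar>ln c\<bar>"
  let ?g = "\<lambda>x. v t x * max 0 (ln (v t x)) + ?D * v t x"
  have g: "integrable \<pi> ?g"
    using v_LlogL[OF t] v_integrable[OF t] by (auto simp: LlogL_def)
  have gnn: "0 \<le> ?g x" for x using v_pos[OF t, of x] t by auto
  have le: "ennreal (v t x) * ennreal (ln (v t y) + ?C) \<le> ennreal (?g x) + ennreal (v t y)" for x y
  proof -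
    have "v t x * (ln (v t y) + ?C) \<le> v t x * (max 0 (ln (v t y)) + ?D)"
      using v_pos[OF t, of x] by (intro mult_left_mono) auto
    also have "\<dots> \<le> ?g x + v t y"
      using mult_ln_pos_le[of "v t y" "v t x"] v_pos[OF t] by (simp add: less_imp_le algebra_simps)
    finally have "ennreal (v t x * (ln (v t y) + ?C)) \<le> ennreal (?g x + v t y)" by (rule ennreal_leI)
    then show ?thesis using gnn[of x] v_pos[OF t] by (simp add: ennreal_mult' less_imp_le)
  qed
  have sets_P[measurable_cong]: "sets (P x) = sets borel" for x
    using measurable_space[OF P, of x] by (simp add: space_prob_algebra)
  have m[measurable]: "(\<lambda>x. \<integral>\<^sup>+y. ennreal (v t y) \<partial>P x) \<in> borel_measurable \<pi>"
    by (rule measurable_compose[OF P_sub' nn_integral_measurable_subprob_algebra]) measurable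
  have "(\<integral>\<^sup>+x. ennreal (v t x) * (\<integral>\<^sup>+y. ennreal (ln (v t y) + ?C) \<partial>P x) \<partial>\<pi>) =
      (\<integral>\<^sup>+x. (\<integral>\<^sup>+y. ennreal (v t x) * ennreal (ln (v t y) + ?C) \<partial>P x) \<partial>\<pi>)"
    by (intro nn_integral_cong nn_integral_cmult[symmetric]) measurable
  also have "\<dots> \<le> (\<integral>\<^sup>+x. (\<integral>\<^sup>+y. ennreal (?g x) + ennreal (v t y) \<partial>P x) \<partial>\<pi>)"
    by (intro nn_integral_mono le)
  also have "\<dots> = (\<integral>\<^sup>+x. ennreal (?g x) + (\<integral>\<^sup>+y. ennreal (v t y) \<partial>P x) \<partial>\<pi>)"
    by (intro nn_integral_cong, subst nn_integral_add) (simp_all add: kernel_space_1)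
  also have "\<dots> = (\<integral>\<^sup>+x. ennreal (?g x) \<partial>\<pi>) + (\<integral>\<^sup>+x. (\<integral>\<^sup>+y. ennreal (v t y) \<partial>P x) \<partial>\<pi>)"
    by (intro nn_integral_add) measurable
  also have "(\<integral>\<^sup>+x. (\<integral>\<^sup>+y. ennreal (v t y) \<partial>P x) \<partial>\<pi>) = (\<integral>\<^sup>+x. ennreal (v t x) \<partial>\<pi>)"
    by (rule nn_integral_P) measurable
  also have "(\<integral>\<^sup>+x. ennreal (?g x) \<partial>\<pi>) = ennreal (\<integral>x. ?g x \<partial>\<pi>)"
    using gnn by (intro nn_integral_eq_integral[OF g]) auto
  also have "ennreal (\<integral>x. ?g x \<partial>\<pi>) + (\<integral>\<^sup>+x. ennreal (v t x) \<partial>\<pi>) < \<infinity>"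
    by (simp add: nn_integral_v_1[OF t])
  finally have fin: "(\<integral>\<^sup>+x. ennreal (v t x) * (\<integral>\<^sup>+y. ennreal (ln (v t y) + ?C) \<partial>P x) \<partial>\<pi>) < \<infinity>" .
  have mm: "(\<lambda>y. ln (v t y)) \<in> borel_measurable borel" by measurable
  note k = kernel_integral[OF P' mm ln_v_ge[OF t] v_integrable[OF t] v_pos[OF t] fin]
  show "AE x in \<pi>. integrable (P x) (\<lambda>y. ln (v t y))"
    and "integrable \<pi> (\<lambda>x. v t x * (\<integral>y. ln (v t y) \<partial>P x))"
    using k(1,2) by auto
qed

text \<open>Invariance of \<^term>\<open>\<pi>\<close> enters here: integrating
  \<open>v x * ln (v y / v x) \<le> v y - v x\<close> against \<open>\<pi>(dx) P(x,dy)\<close> gives \<open>0\<close> on the right.\<close>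

lemma P_dissipation:
  assumes t: "0 \<le> t"
  shows "(\<integral>x. v t x * (\<integral>y. ln (v t y) \<partial>P x) \<partial>\<pi>) \<le> (\<integral>x. v t x * ln (v t x) \<partial>\<pi>)"
proof -
  have m: "v t \<in> borel_measurable borel" by measurable
  \<comment> \<open>\<open>kernel_integral\<close> is used with weight 1 and integrand
    \<open>v t\<close>, bounded below by 0: the mean of \<open>v t\<close> under \<open>P x\<close>
    is finite for almost every \<open>x\<close>, and integrates to 1 by invariance.\<close>
  have eq: "(\<integral>\<^sup>+x. ennreal 1 * (\<integral>\<^sup>+y. ennreal (v t y + 0) \<partial>P x) \<partial>\<pi>) = 1"
    using nn_integral_P[of "\<lambda>y. ennreal (v t y)"] nn_integral_v_1[OF t] by simp
  have fin: "(\<integral>\<^sup>+x. ennreal 1 * (\<integral>\<^sup>+y. ennreal (v t y + 0) \<partial>P x) \<partial>\<pi>) < \<infinity>" unfolding eq by simp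
  have v0: "- 0 \<le> v t y" for y using v_pos[OF t, of y] by simp
  have i1: "integrable \<pi> (\<lambda>_. 1 :: real)" by simp
  note k = kernel_integral[OF P' m v0 i1 zero_less_one fin, unfolded eq]
  have "AE x in \<pi>. v t x * (\<integral>y. ln (v t y) \<partial>P x) \<le> v t x * ln (v t x) + ((\<integral>y. v t y \<partial>P x) - v t x)"
    using P_ln_v(1)[OF t] k(1)
  proof eventually_elim
    case (elim x)
    interpret P: prob_space "P x"
      using measurable_space[OF P, of x] by (simp add: space_prob_algebra)
    have "v t x * ln (v t y) \<le> v t x * ln (v t x) - v t x + v t y" for y
    proof -
      have "v t x * ln (v t y / v t x) \<le> v t x * (v t y / v t x - 1)"
        using v_pos[OF t] by (intro mult_left_mono ln_le_minus_one divide_pos_pos) (auto simp: less_imp_le)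
      then show ?thesis using v_pos[OF t, of x] v_pos[OF t, of y] by (simp add: ln_div algebra_simps)
    qed
    then have "(\<integral>y. v t x * ln (v t y) \<partial>P x) \<le> (\<integral>y. v t x * ln (v t x) - v t x + v t y \<partial>P x)"
      using elim by (intro integral_mono) auto
    then show ?case using elim by (simp add: P.prob_space)
  qed
  then have "(\<integral>x. v t x * (\<integral>y. ln (v t y) \<partial>P x) \<partial>\<pi>) \<le>
      (\<integral>x. v t x * ln (v t x) + ((\<integral>y. v t y \<partial>P x) - v t x) \<partial>\<pi>)"
    using P_ln_v(2)[OF t] q_ln_v_integrable(2)[OF t] v_integrable[OF t] k(2)
    by (intro integral_mono_AE) auto
  also have "\<dots> = (\<integral>x. v t x * ln (v t x) \<partial>\<pi>) + ((\<integral>x. (\<integral>y. v t y \<partial>P x) \<partial>\<pi>) - (\<integral>x. v t x \<partial>\<pi>))"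
    using q_ln_v_integrable(2)[OF t] v_integrable[OF t] k(2) by simp
  also have "(\<integral>x. (\<integral>y. v t y \<partial>P x) \<partial>\<pi>) = 1" using k(3) by simp
  finally show ?thesis by (simp add: integral_v[OF t])
qed

lemma expansion_defined_v:
  assumes t: "0 \<le> t"
  shows "expansion_defined \<pi> P Q (v t)"
  unfolding expansion_defined_def using Q_ln_v[OF t] P_ln_v[OF t] v_pos[OF t]
  by (simp add: right_diff_distrib)

lemma expansion_term_v:
  assumes t: "0 \<le> t"
  shows "expansion_term \<pi> P Q (v t) =
    (\<integral>x. q t x * ln (v t x) \<partial>\<pi>) - (\<integral>x. v t x * (\<integral>y. ln (v t y) \<partial>P x) \<partial>\<pi>)"
  unfolding expansion_term_def using Q_ln_v[OF t] P_ln_v[OF t]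
  by (simp add: right_diff_distrib)

text \<open>The candidate for the time derivative of the entropy: \<open>ln (v t x) + 1\<close> is
  the derivative of x ln x at \<open>v t x\<close>, multiplied by the rate
  \<open>q t x - v t x\<close>. The summand 1 contributes nothing, since both masses are 1.\<close>

definition dissip :: "real \<Rightarrow> real" where
  "dissip t = (\<integral>x. (q t x - v t x) * (ln (v t x) + 1) \<partial>\<pi>)"

text \<open>By duality the \<open>Q\<close> part of the expansion term equals the integral of
  \<open>q t x * ln (v t x)\<close>. The remaining terms are compared by
  \<open>P_dissipation\<close>.\<close>

lemma dissip_le_expansion:
  assumes t: "0 \<le> t"
  shows "dissip t \<le> expansion_term \<pi> P Q (v t)"
proof -
  have "(q t x - v t x) * (ln (v t x) + 1) =
    (q t x * ln (v t x) - v t x * ln (v t x)) + (q t x - v t x)" for x by (simp add: algebra_simps)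
  then have "dissip t = (\<integral>x. q t x * ln (v t x) \<partial>\<pi>) - (\<integral>x. v t x * ln (v t x) \<partial>\<pi>)"
    using q_ln_v_integrable[OF t] v_integrable[OF t] q_integrable[OF t]
    by (simp add: dissip_def integral_v[OF t] integral_q[OF t])
  then show ?thesis using P_dissipation[OF t] expansion_term_v[OF t] by simp
qed

text \<open>A bound uniform on [0, T], for integrability in time. The \<open>P\<close> part is
  controlled from above by \<open>P_dissipation\<close> and from below by the lower bound on
  \<open>ln (v t y)\<close> with the unit mass of \<open>v t\<close>.\<close>

lemma expansion_term_bounded:
  assumes t: "0 \<le> t" "t \<le> T"
  shows "\<bar>expansion_term \<pi> P Q (v t)\<bar> \<le>
    (\<integral>x. exp T * q T x * H T x \<partial>\<pi>) + (\<integral>x. exp T * v T x * H T x \<partial>\<pi>) + (T + \<bar>ln c\<bar>)"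
proof -
  have T: "0 \<le> T" using t by simp
  have 1: "\<bar>\<integral>x. q t x * ln (v t x) \<partial>\<pi>\<bar> \<le> (\<integral>x. exp T * q T x * H T x \<partial>\<pi>)"
    by (rule order_trans[OF integral_abs_bound])
      (intro integral_mono integrable_abs q_ln_v_integrable q_H_integrable q_ln_v_le t T)
  have "(\<integral>x. v t x * ln (v t x) \<partial>\<pi>) \<le> (\<integral>x. exp T * v T x * H T x \<partial>\<pi>)"
    by (intro integral_mono q_ln_v_integrable v_H_integrable t T order_trans[OF abs_ge_self q_ln_v_le(2)])
  then have 2: "(\<integral>x. v t x * (\<integral>y. ln (v t y) \<partial>P x) \<partial>\<pi>) \<le> (\<integral>x. exp T * v T x * H T x \<partial>\<pi>)"
    using P_dissipation[OF t(1)] by simp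
  have "AE x in \<pi>. v t x * - (t - ln c) \<le> v t x * (\<integral>y. ln (v t y) \<partial>P x)"
    using P_ln_v(1)[OF t(1)]
  proof eventually_elim
    case (elim x)
    interpret P: prob_space "P x"
      using measurable_space[OF P, of x] by (simp add: space_prob_algebra)
    have "- (t - ln c) \<le> (\<integral>y. ln (v t y) \<partial>P x)"
      using elim ln_v_ge[OF t(1)] by (intro P.integral_ge_const) auto
    then show ?case using v_pos[OF t(1), of x] by (intro mult_left_mono) auto
  qed
  then have "(\<integral>x. v t x * - (t - ln c) \<partial>\<pi>) \<le> (\<integral>x. v t x * (\<integral>y. ln (v t y) \<partial>P x) \<partial>\<pi>)"
    using v_integrable[OF t(1)] P_ln_v(2)[OF t(1)] by (intro integral_mono_AE) auto
  then have 3: "- (t - ln c) \<le> (\<integral>x. v t x * (\<integral>y. ln (v t y) \<partial>P x) \<partial>\<pi>)"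
    using v_integrable[OF t(1)] integral_v[OF t(1)] by simp
  have 4: "0 \<le> (\<integral>x. exp T * v T x * H T x \<partial>\<pi>)"
    using v_pos[OF T] H_nonneg[OF T] by (intro integral_nonneg_AE) (auto simp: less_imp_le)
  show ?thesis unfolding expansion_term_v[OF t(1)] using 1 2 3 4 t by linarith
qed

lemma expansion_set_integrable:
  assumes T: "0 \<le> T"
  shows "set_integrable lborel {0..T} (\<lambda>t. expansion_term \<pi> P Q (v t))"
proof -
  have [measurable]: "(\<lambda>t. expansion_term \<pi> P Q (v t)) \<in> borel_measurable borel"
  proof -
    \<comment> \<open>Time enters through the integrand and space through the kernel, so joint
      measurability needs the parameter-dependent \<open>integral_measurable_kernel\<close>.\<close>
    have k: "(\<lambda>z. \<integral>y. ln (v (fst z) y) \<partial>K (snd z)) \<in> borel_measurable (borel \<Otimes>\<^sub>M \<pi>)"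
      if K[measurable]: "K \<in> \<pi> \<rightarrow>\<^sub>M subprob_algebra borel" for K
      by (rule integral_measurable_kernel[of _ _ borel]) measurable
    note [measurable] = k[OF P_sub'] k[OF Q_sub']
    show ?thesis unfolding expansion_term_def
      by (intro borel_measurable_lebesgue_integral)
         (use k[OF P_sub'] k[OF Q_sub'] in \<open>simp add: split_beta'\<close>)
  qed
  show ?thesis unfolding set_integrable_def
  proof (rule Bochner_Integration.integrable_bound)
    let ?B = "(\<integral>x. exp T * q T x * H T x \<partial>\<pi>) + (\<integral>x. exp T * v T x * H T x \<partial>\<pi>) + (T + \<bar>ln c\<bar>)"
    have "integrable lborel (indicat_real {0..T})" by (rule integrable_real_indicator) (simp_all add: emeasure_lborel_Icc_eq)
    then show "integrable lborel (\<lambda>t. indicator {0..T} t *\<^sub>R ?B)" by simp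
    show "AE t in lborel. norm (indicator {0..T} t *\<^sub>R expansion_term \<pi> P Q (v t)) \<le>
        norm (indicator {0..T} t *\<^sub>R ?B)"
      using expansion_term_bounded[of _ T] T
      by (auto split: split_indicator intro: order_trans[OF _ abs_ge_self])
  qed measurable
qed

text \<open>The fundamental theorem of calculus is applied to \<open>v s x * ln (v s x)\<close> at
  each fixed \<open>x\<close>, and Fubini then exchanges time and space. Differentiation under the
  integral is thereby avoided; one integrable majorant \<open>?G\<close> suffices.\<close>

lemma entropy_identity:
  assumes T: "0 \<le> T"
  shows "set_integrable lborel {0..T} dissip"
    and "(\<integral>x. v T x * ln (v T x) \<partial>\<pi>) - (\<integral>x. u 0 x * ln (u 0 x) \<partial>\<pi>) = (LINT t:{0..T}|lborel. dissip t)"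
proof -
  interpret PS: pair_sigma_finite \<pi> lborel ..
  let ?g = "\<lambda>t x. (q t x - v t x) * (ln (v t x) + 1)"
  let ?f = "\<lambda>x t. indicator {0..T} t * ?g t x"
  \<comment> \<open>The first factor dominates \<open>\<bar>q t x - v t x\<bar>\<close> and the
    second \<open>\<bar>ln (v t x) + 1\<bar>\<close>, for every \<open>t\<close> in [0, T].\<close>
  let ?G = "\<lambda>x. (exp T * q T x + exp T * v T x) * (H T x + 1)"
  have G: "integrable \<pi> ?G"
    using v_H_integrable[OF T] q_H_integrable[OF T] v_integrable[OF T] q_integrable[OF T]
    by (simp add: distrib_left distrib_right)
  have Gnn: "0 \<le> ?G x" for x
    using q_nonneg[OF T, of x] v_pos[OF T, of x] H_nonneg[OF T, of x]
    by (intro mult_nonneg_nonneg) auto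
  have le: "\<bar>?g t x\<bar> \<le> ?G x" if "t \<in> {0..T}" for t x
  proof -
    have t: "0 \<le> t" "t \<le> T" using that by auto
    have "\<bar>q t x - v t x\<bar> \<le> exp T * q T x + exp T * v T x"
      using v_q_le[OF t, of x] q_nonneg[OF t(1), of x] v_pos[OF t(1), of x] by linarith
    moreover have "\<bar>ln (v t x) + 1\<bar> \<le> H T x + 1" using abs_ln_v_le[OF t, of x] by linarith
    ultimately show ?thesis unfolding abs_mult
      using q_nonneg[OF T, of x] v_pos[OF T, of x] by (intro mult_mono) auto
  qed
  have "integrable (\<pi> \<Otimes>\<^sub>M lborel) (\<lambda>(x, t). indicator {0..T} t * ?G x)"
  proof (rule PS.Fubini_integrable)
    have "norm (indicator {0..T} t * ?G x) = indicator {0..T} t * ?G x" for t x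
      using Gnn[of x] by (simp add: abs_of_nonneg split: split_indicator)
    then have "(\<integral>t. norm (case (x, t) of (x, t) \<Rightarrow> indicator {0..T} t * ?G x) \<partial>lborel) = T * ?G x" for x
      using T by simp
    then show "integrable \<pi> (\<lambda>x. \<integral>t. norm (case (x, t) of (x, t) \<Rightarrow> indicator {0..T} t * ?G x) \<partial>lborel)"
      using G by simp
    have "integrable lborel (indicat_real {0..T})" by (rule integrable_real_indicator) (simp_all add: emeasure_lborel_Icc_eq)
    then show "AE x in \<pi>. integrable lborel (\<lambda>t. case (x, t) of (x, t) \<Rightarrow> indicator {0..T} t * ?G x)"
      by simp
  qed auto
  then have int: "integrable (\<pi> \<Otimes>\<^sub>M lborel) (\<lambda>(x, t). ?f x t)"
    by (rule Bochner_Integration.integrable_bound)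
       (use le Gnn in \<open>auto split: split_indicator intro: order_trans[OF _ abs_ge_self]\<close>)
  have d: "(\<integral>x. ?f x t \<partial>\<pi>) = indicator {0..T} t *\<^sub>R dissip t" for t
    by (simp add: dissip_def)
  show "set_integrable lborel {0..T} dissip"
    using PS.integrable_snd[OF int] unfolding set_integrable_def d .
  have "(LINT t:{0..T}|lborel. dissip t) = (\<integral>t. (\<integral>x. ?f x t \<partial>\<pi>) \<partial>lborel)"
    unfolding set_lebesgue_integral_def d ..
  also have "\<dots> = (\<integral>x. (\<integral>t. ?f x t \<partial>lborel) \<partial>\<pi>)"
    by (rule PS.Fubini_integral[OF int])
  also have "\<dots> = (\<integral>x. v T x * ln (v T x) - u 0 x * ln (u 0 x) \<partial>\<pi>)"
  proof (rule Bochner_Integration.integral_cong[OF refl])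
    fix x
    have "((\<lambda>s. v s x * ln (v s x)) has_real_derivative ?g t x) (at t)" if "0 \<le> t" for t
      using v_pos[OF that, of x] by (auto intro!: derivative_eq_intros v_deriv simp: field_simps)
    then have D: "((\<lambda>s. v s x * ln (v s x)) has_vector_derivative ?g t x) (at t within {0..T})"
      if "0 \<le> t" for t
      using that unfolding has_real_derivative_iff_has_vector_derivative
      by (auto intro: has_vector_derivative_at_within)
    have "isCont (\<lambda>t. ?g t x) t" if "0 \<le> t" for t
      using v_pos[OF that, of x] by (intro continuous_intros q_isCont DERIV_isCont[OF v_deriv]) auto
    then have cont: "continuous_on {0..T} (\<lambda>t. ?g t x)"
      by (intro continuous_at_imp_continuous_on) auto
    show "(\<integral>t. ?f x t \<partial>lborel) = v T x * ln (v T x) - u 0 x * ln (u 0 x)"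
      using integral_FTC_atLeastAtMost[OF T D cont] by (simp add: v_0)
  qed
  also have "\<dots> = (\<integral>x. v T x * ln (v T x) \<partial>\<pi>) - (\<integral>x. u 0 x * ln (u 0 x) \<partial>\<pi>)"
    using q_ln_v_integrable(2)[OF T] entropy_0 by simp
  finally show "(\<integral>x. v T x * ln (v T x) \<partial>\<pi>) - (\<integral>x. u 0 x * ln (u 0 x) \<partial>\<pi>) =
    (LINT t:{0..T}|lborel. dissip t)" ..
qed

lemma entropy_expansion:
  assumes T: "0 \<le> T"
  shows "(\<integral>x. v T x * ln (v T x) \<partial>\<pi>) \<le>
    (\<integral>x. u 0 x * ln (u 0 x) \<partial>\<pi>) + (LINT t:{0..T}|lborel. expansion_term \<pi> P Q (v t))"
proof -
  have "(LINT t:{0..T}|lborel. dissip t) \<le> (LINT t:{0..T}|lborel. expansion_term \<pi> P Q (v t))"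
    using entropy_identity(1)[OF T] expansion_set_integrable[OF T] dissip_le_expansion
    by (intro set_integral_mono) auto
  then show ?thesis using entropy_identity(2)[OF T] by simp
qed

end

subsection \<open>Laws of the Poissonized chain\<close>

lemma poissonized_measurable:
  assumes "\<And>k. X k \<in> borel_measurable M" "N t \<in> M \<rightarrow>\<^sub>M count_space UNIV"
  shows "poissonized X N t \<in> borel_measurable M"
proof -
  have "(\<lambda>\<omega>. X (N t \<omega>) \<omega>) \<in> borel_measurable M"
    by (rule measurable_compose_countable[of X, OF assms])
  then show ?thesis by (simp add: poissonized_def[abs_def])
qed

text \<open>The process starts at 0 almost surely, so \<open>N t\<close> agrees with its increment
  over [0, t]. Increment laws are prescribed only for \<open>s < t\<close>, so \<open>t = 0\<close>
  is treated directly.\<close>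

lemma poisson_process_marginal:
  assumes M: "prob_space M" and N: "poisson_process M 1 N" and t: "0 \<le> t"
  shows "measure M {\<omega> \<in> space M. N t \<omega> = k} = exp (- t) * t ^ k / fact k"
proof -
  interpret prob_space M by fact
  have Nm[measurable]: "N s \<in> M \<rightarrow>\<^sub>M count_space UNIV" if "0 \<le> s" for s
    using N that by (auto simp: poisson_process_def)
  have N0: "AE \<omega> in M. N 0 \<omega> = 0" using N by (auto simp: poisson_process_def)
  have [measurable]: "N t \<in> M \<rightarrow>\<^sub>M count_space UNIV" "N 0 \<in> M \<rightarrow>\<^sub>M count_space UNIV"
    using Nm t by auto
  show ?thesis
  proof (cases "t = 0")
    case True
    have "measure M {\<omega> \<in> space M. N t \<omega> = k} = measure M {\<omega> \<in> space M. k = 0}"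
      using N0 True by (intro measure_eq_AE) auto
    \<comment> \<open>With \<open>0 ^ 0 = 1\<close> the formula at time 0 gives the point mass at
      \<open>k = 0\<close>.\<close>
    then show ?thesis using True by (cases "k = 0") (auto simp: prob_space)
  next
    case False
    then have "0 < t" using t by simp
    then have d: "distr M (count_space UNIV) (\<lambda>\<omega>. N t \<omega> - N 0 \<omega>) = measure_pmf (poisson_pmf t)"
      using N by (auto simp: poisson_process_def)
    have "measure M {\<omega> \<in> space M. N t \<omega> = k} = measure M {\<omega> \<in> space M. N t \<omega> - N 0 \<omega> = k}"
      using N0 by (intro measure_eq_AE) auto
    also have "\<dots> = measure (distr M (count_space UNIV) (\<lambda>\<omega>. N t \<omega> - N 0 \<omega>)) {k}"
      by (subst measure_distr) (auto intro!: arg_cong[where f="measure M"])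
    also have "\<dots> = exp (- t) * t ^ k / fact k"
      unfolding d using \<open>0 < t\<close> by (simp add: measure_pmf_single)
    finally show ?thesis .
  qed
qed

text \<open>The event is split by the number of jumps: where \<open>N t \<omega> = k\<close> the
  process sits at \<open>X k \<omega>\<close>, and independence factors the probability.\<close>

lemma emeasure_poissonized_law:
  fixes X :: "nat \<Rightarrow> 'w \<Rightarrow> 'a::topological_space"
  assumes M: "prob_space M" and N: "poisson_process M 1 N" and X[measurable]: "\<And>k. X k \<in> borel_measurable M"
    and ind: "indep_processes M X N" and t: "0 \<le> t" and B[measurable]: "B \<in> sets borel"
  shows "emeasure (poissonized_law M X N t) B =
    (\<Sum>k. ennreal (exp (- t) * t ^ k / fact k) * emeasure (distr M borel (X k)) B)"
proof -
  interpret prob_space M by fact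
  have Nm[measurable]: "N t \<in> M \<rightarrow>\<^sub>M count_space UNIV"
    using N t unfolding poisson_process_def by blast
  have [measurable]: "poissonized X N t \<in> borel_measurable M"
    by (intro poissonized_measurable X Nm)
  have t': "t \<in> {0..}" using t by simp
  define E where "E k = {\<omega> \<in> space M. X k \<omega> \<in> B}" for k
  define F where "F k = {\<omega> \<in> space M. N t \<omega> = k}" for k
  have EF[measurable]: "E k \<in> sets M" "F k \<in> sets M" for k by (simp_all add: E_def F_def)
  have prob: "prob (E k \<inter> F k) = prob (E k) * prob (F k)" for k
  \<comment> \<open>\<open>E k\<close> is determined by the chain and \<open>F k\<close> by the jump
    process; writing both as preimages places them in the two independent sigma-algebras.\<close>
  proof (rule indep_setD[OF ind[unfolded indep_processes_def]])
    have "{f \<in> space (Pi\<^sub>M UNIV (\<lambda>_. borel)). f k \<in> B} \<in> sets (Pi\<^sub>M (UNIV :: nat set) (\<lambda>_. borel :: 'a measure))"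
      by measurable
    from in_vimage_algebra[OF this, of "\<lambda>\<omega> k. X k \<omega>" "space M"]
    show "E k \<in> sets (vimage_algebra (space M) (\<lambda>\<omega> k. X k \<omega>) (Pi\<^sub>M UNIV (\<lambda>_. borel)))"
      by (rule back_subst[where P="\<lambda>A. A \<in> _"]) (auto simp: E_def space_PiM)
    have "{f \<in> space (Pi\<^sub>M {0..} (\<lambda>_. count_space UNIV)). f t = k} \<in>
        sets (Pi\<^sub>M {0::real..} (\<lambda>_. count_space UNIV :: nat measure))"
      using t' by measurable
    from in_vimage_algebra[OF this, of "\<lambda>\<omega>. \<lambda>t\<in>{0..}. N t \<omega>" "space M"]
    show "F k \<in> sets (vimage_algebra (space M) (\<lambda>\<omega>. \<lambda>t\<in>{0..}. N t \<omega>) (Pi\<^sub>M {0..} (\<lambda>_. count_space UNIV)))"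
      by (rule back_subst[where P="\<lambda>A. A \<in> _"]) (use t in \<open>auto simp: F_def space_PiM\<close>)
  qed
  have probF: "prob (F k) = exp (- t) * t ^ k / fact k" for k
    unfolding F_def by (rule poisson_process_marginal[OF M N t])
  have probE: "emeasure (distr M borel (X k)) B = ennreal (prob (E k))" for k
  proof -
    have "X k -` B \<inter> space M = E k" unfolding E_def by blast
    then show ?thesis unfolding emeasure_distr[OF X B] emeasure_eq_measure by simp
  qed
  have ef: "emeasure M (E k \<inter> F k) =
      ennreal (exp (- t) * t ^ k / fact k) * emeasure (distr M borel (X k)) B" for k
    unfolding probE emeasure_eq_measure prob probF
    by (subst mult.commute, rule ennreal_mult'') simp
  have "poissonized X N t -` B \<inter> space M = (\<Union>k. E k \<inter> F k)"
    unfolding E_def F_def poissonized_def by blast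
  then have "emeasure (poissonized_law M X N t) B = emeasure M (\<Union>k. E k \<inter> F k)"
    unfolding poissonized_law_def by (subst emeasure_distr) simp_all
  also have "\<dots> = (\<Sum>k. emeasure M (E k \<inter> F k))"
  proof (rule suminf_emeasure[symmetric])
    show "disjoint_family (\<lambda>k. E k \<inter> F k)" by (auto simp: disjoint_family_on_def F_def)
    show "range (\<lambda>k. E k \<inter> F k) \<subseteq> sets M" by (intro image_subsetI sets.Int EF)
  qed
  finally show ?thesis by (simp only: ef)
qed

text \<open>Expectations are taken in the Markov property: by the tower rule the conditioning
  disappears, leaving a recursion for the marginal laws.\<close>

lemma markov_chain_step:
  fixes X :: "nat \<Rightarrow> 'w \<Rightarrow> 'a::topological_space"
  assumes M: "prob_space M" and K: "K \<in> borel \<rightarrow>\<^sub>M prob_algebra borel" and X: "markov_chain M K \<mu>0 X"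
  shows "distr M borel (X (Suc k)) = bind (distr M borel (X k)) K"
proof -
  interpret prob_space M by fact
  have Xm[measurable]: "X k \<in> borel_measurable M" for k using X by (simp add: markov_chain_def)
  have Ks[measurable]: "K \<in> borel \<rightarrow>\<^sub>M subprob_algebra borel" using K by (rule measurable_prob_algebraD)
  have Kp: "prob_space (K x)" for x
    using measurable_space[OF K, of x] by (simp add: space_prob_algebra)
  have Kd: "K \<in> distr M borel (X k) \<rightarrow>\<^sub>M subprob_algebra borel" using Ks by simp
  show ?thesis
  proof (rule measure_eqI)
    have "sets (bind (distr M borel (X k)) K) = sets borel"
      using measurable_space[OF K] by (intro sets_bind) (auto simp: space_prob_algebra)
    then show "sets (distr M borel (X (Suc k))) = sets (bind (distr M borel (X k)) K)" by simp
  next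
    fix A assume "A \<in> sets (distr M borel (X (Suc k)))"
    then have A[measurable]: "A \<in> sets borel" by simp
    define F where "F = vimage_algebra (space M) (\<lambda>\<omega>. \<lambda>i\<in>{..k}. X i \<omega>) (Pi\<^sub>M {..k} (\<lambda>_. borel :: 'a measure))"
    have "(\<lambda>\<omega>. \<lambda>i\<in>{..k}. X i \<omega>) \<in> M \<rightarrow>\<^sub>M Pi\<^sub>M {..k} (\<lambda>_. borel :: 'a measure)"
      by measurable
    then have "subalgebra M F"
      unfolding subalgebra_def F_def by (intro conjI sets_image_in_sets) simp_all
    then have "finite_measure_subalgebra M F"
      by (intro finite_measure_subalgebra.intro finite_measure_subalgebra_axioms.intro finite_measure_axioms)
    then interpret F: finite_measure_subalgebra M F .
    have i: "integrable M (\<lambda>\<omega>. indicator A (X (Suc k) \<omega>) :: real)"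
      by (rule integrable_const_bound[of _ 1]) (auto simp: indicator_def)
    have mK[measurable]: "(\<lambda>\<omega>. measure (K (X k \<omega>)) A) \<in> borel_measurable M"
      by (intro measurable_compose[OF Xm] measurable_compose[OF Ks] measurable_measure_subprob_algebra A)
    have ae: "AE \<omega> in M. real_cond_exp M F (\<lambda>\<omega>. indicator A (X (Suc k) \<omega>)) \<omega> = measure (K (X k \<omega>)) A"
      using X A unfolding markov_chain_def F_def by blast
    have iK: "integrable M (\<lambda>\<omega>. measure (K (X k \<omega>)) A)"
      using prob_space.prob_le_1[OF Kp] by (intro integrable_const_bound[OF _ mK, of 1] AE_I2) simp
    have ind: "(\<lambda>\<omega>. indicator A (X (Suc k) \<omega>)) = indicat_real (X (Suc k) -` A)"
      by (auto simp: fun_eq_iff split: split_indicator)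
    have "measure M (X (Suc k) -` A \<inter> space M) = (\<integral>\<omega>. indicator A (X (Suc k) \<omega>) \<partial>M)"
      unfolding ind by simp
    also have "\<dots> = (\<integral>\<omega>. real_cond_exp M F (\<lambda>\<omega>. indicator A (X (Suc k) \<omega>)) \<omega> \<partial>M)"
      by (rule F.real_cond_exp_int(2)[OF i, symmetric])
    also have "\<dots> = (\<integral>\<omega>. measure (K (X k \<omega>)) A \<partial>M)"
      by (rule integral_cong_AE[OF borel_measurable_cond_exp2 mK ae])
    finally have "emeasure (distr M borel (X (Suc k))) A = ennreal (\<integral>\<omega>. measure (K (X k \<omega>)) A \<partial>M)"
      by (simp add: emeasure_distr emeasure_eq_measure)
    also have "\<dots> = (\<integral>\<^sup>+\<omega>. ennreal (measure (K (X k \<omega>)) A) \<partial>M)"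
      by (rule nn_integral_eq_integral[OF iK, symmetric]) simp
    also have "\<dots> = (\<integral>\<^sup>+\<omega>. emeasure (K (X k \<omega>)) A \<partial>M)"
      by (intro nn_integral_cong finite_measure.emeasure_eq_measure[symmetric] prob_space.finite_measure Kp)
    also have "\<dots> = (\<integral>\<^sup>+x. emeasure (K x) A \<partial>distr M borel (X k))"
      by (rule nn_integral_distr[symmetric, OF Xm])
        (intro measurable_compose[OF Kd] measurable_emeasure_subprob_algebra A)
    also have "\<dots> = emeasure (bind (distr M borel (X k)) K) A"
      by (rule emeasure_bind[symmetric, OF _ Kd A]) simp
    finally show "emeasure (distr M borel (X (Suc k))) A = emeasure (bind (distr M borel (X k)) K) A" .
  qed
qed

text \<open>Changing a density on a \<pi>-null set must not alter the inner kernel integrals either.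
  Such a set is null for \<open>bind \<pi> K\<close> by absolute continuity, hence null for
  \<open>K x\<close> for almost every \<open>x\<close>.\<close>

lemma expansion_cong:
  fixes \<pi> :: "'a::topological_space measure"
  assumes sets_pi: "sets \<pi> = sets borel"
    and P: "P \<in> borel \<rightarrow>\<^sub>M subprob_algebra borel" and Q: "Q \<in> borel \<rightarrow>\<^sub>M subprob_algebra borel"
    and acP: "absolutely_continuous \<pi> (bind \<pi> P)" and acQ: "absolutely_continuous \<pi> (bind \<pi> Q)"
    and f[measurable]: "f \<in> borel_measurable borel" and g[measurable]: "g \<in> borel_measurable borel"
    and eq: "AE x in \<pi>. f x = g x"
  shows "expansion_term \<pi> P Q f = expansion_term \<pi> P Q g"
    and "expansion_defined \<pi> P Q f \<longleftrightarrow> expansion_defined \<pi> P Q g"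
proof -
  have K: "AE x in \<pi>. AE y in K x. f y = g y" "(\<lambda>x. \<integral>y. ln (h y) \<partial>K x) \<in> borel_measurable \<pi>"
    "\<And>x. sets (K x) = sets borel"
    if K: "K \<in> borel \<rightarrow>\<^sub>M subprob_algebra borel" and ac: "absolutely_continuous \<pi> (bind \<pi> K)"
      and h[measurable]: "h \<in> borel_measurable borel" for K and h :: "'a \<Rightarrow> real"
  proof -
    have K': "K \<in> \<pi> \<rightarrow>\<^sub>M subprob_algebra borel" using K by (simp add: measurable_cong_sets[OF sets_pi refl])
    show s: "sets (K x) = sets borel" for x using sets_kernel[OF K] by simp
    have "sets (bind \<pi> K) = sets \<pi>"
      using s sets_eq_imp_space_eq[OF sets_pi] by (subst sets_bind[where N=borel]) (auto simp: sets_pi)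
    from absolutely_continuous_AE[OF this ac eq]
    show "AE x in \<pi>. AE y in K x. f y = g y"
      by (subst (asm) AE_bind[OF K']) auto
    show "(\<lambda>x. \<integral>y. ln (h y) \<partial>K x) \<in> borel_measurable \<pi>"
      by (rule measurable_compose[OF K' integral_measurable_subprob_algebra]) simp
  qed
  have [measurable]: "f \<in> borel_measurable \<pi>" "g \<in> borel_measurable \<pi>"
    using f g by (simp_all add: measurable_cong_sets[OF sets_pi refl])
  note Pf = K[OF P acP f] and Pg = K[OF P acP g] and Qf = K[OF Q acQ f] and Qg = K[OF Q acQ g]
  note [measurable] = Pf(2) Pg(2) Qf(2) Qg(2)
  have KE: "integrable L (\<lambda>y. ln (f y)) \<longleftrightarrow> integrable L (\<lambda>y. ln (g y))"
      "(\<integral>y. ln (f y) \<partial>L) = (\<integral>y. ln (g y) \<partial>L)"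
    if s: "sets L = sets borel" and ae: "AE y in L. f y = g y" for L
  proof -
    have [measurable]: "f \<in> borel_measurable L" "g \<in> borel_measurable L"
      using f g by (simp_all add: measurable_cong_sets[OF s refl])
    have ae': "AE y in L. ln (f y) = ln (g y)" using ae by auto
    show "integrable L (\<lambda>y. ln (f y)) \<longleftrightarrow> integrable L (\<lambda>y. ln (g y))"
      by (rule integrable_cong_AE[OF _ _ ae']) auto
    show "(\<integral>y. ln (f y) \<partial>L) = (\<integral>y. ln (g y) \<partial>L)"
      by (rule integral_cong_AE[OF _ _ ae']) auto
  qed
  let ?D = "\<lambda>f x. f x * ((\<integral>y. ln (f y) \<partial>Q x) - (\<integral>y. ln (f y) \<partial>P x))"
  have D: "AE x in \<pi>. ?D f x = ?D g x"
    using eq Pf(1) Qf(1) by eventually_elim (simp add: KE(2)[OF Pf(3)] KE(2)[OF Qf(3)])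
  show "expansion_term \<pi> P Q f = expansion_term \<pi> P Q g"
    unfolding expansion_term_def by (rule integral_cong_AE[OF _ _ D]) auto
  have "(AE x in \<pi>. 0 < f x \<and> integrable (Q x) (\<lambda>y. ln (f y)) \<and> integrable (P x) (\<lambda>y. ln (f y))) \<longleftrightarrow>
    (AE x in \<pi>. 0 < g x \<and> integrable (Q x) (\<lambda>y. ln (g y)) \<and> integrable (P x) (\<lambda>y. ln (g y)))"
  proof (rule eventually_subst)
    show "AE x in \<pi>. (0 < f x \<and> integrable (Q x) (\<lambda>y. ln (f y)) \<and> integrable (P x) (\<lambda>y. ln (f y))) \<longleftrightarrow>
      (0 < g x \<and> integrable (Q x) (\<lambda>y. ln (g y)) \<and> integrable (P x) (\<lambda>y. ln (g y)))"
      using eq Pf(1) Qf(1) by eventually_elim (simp add: KE(1)[OF Pf(3)] KE(1)[OF Qf(3)])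
  qed
  moreover have "integrable \<pi> (?D f) \<longleftrightarrow> integrable \<pi> (?D g)"
    by (rule integrable_cong_AE[OF _ _ D]) auto
  ultimately show "expansion_defined \<pi> P Q f \<longleftrightarrow> expansion_defined \<pi> P Q g"
    unfolding expansion_defined_def by simp
qed

subsection \<open>The PAC-Bayes bound\<close>

lemma nn_integral_normal_density:
  assumes "0 < \<sigma>"
  shows "(\<integral>\<^sup>+x. ennreal (normal_density \<mu> \<sigma> x) \<partial>lborel) = 1"
  using prob_space.emeasure_space_1[OF prob_space_normal_density[OF assms, of \<mu>]]
  by (simp add: emeasure_density)

text \<open>Completing the square turns the tilted standard normal density into a normal density
  with mean \<open>b\<close>.\<close>

lemma gaussian_mgf: "(\<integral>\<^sup>+g. ennreal (std_normal_density g * exp (g * b)) \<partial>lborel) = ennreal (exp (b\<^sup>2 / 2))"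
proof -
  have "std_normal_density g * exp (g * b) = exp (b\<^sup>2 / 2) * normal_density b 1 g" for g
  proof -
    have "- g\<^sup>2 / 2 + g * b = b\<^sup>2 / 2 - (g - b)\<^sup>2 / 2" by (simp add: power2_eq_square field_simps)
    then have "exp (- g\<^sup>2 / 2) * exp (g * b) = exp (b\<^sup>2 / 2) * exp (- (g - b)\<^sup>2 / 2)"
      by (simp add: exp_add[symmetric])
    then show ?thesis by (simp add: normal_density_def)
  qed
  then have "(\<integral>\<^sup>+g. ennreal (std_normal_density g * exp (g * b)) \<partial>lborel) =
      (\<integral>\<^sup>+g. ennreal (exp (b\<^sup>2 / 2)) * ennreal (normal_density b 1 g) \<partial>lborel)"
    by (simp add: ennreal_mult)
  also have "\<dots> = ennreal (exp (b\<^sup>2 / 2))"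
    by (subst nn_integral_cmult) (simp_all add: nn_integral_normal_density)
  finally show ?thesis .
qed

text \<open>The tilt halves the Gaussian exponent, leaving \<open>sqrt 2\<close> times the normal
  density with standard deviation \<open>sqrt 2\<close>.\<close>

lemma gaussian_exp_square: "(\<integral>\<^sup>+g. ennreal (std_normal_density g * exp (g\<^sup>2 / 4)) \<partial>lborel) = ennreal (sqrt 2)"
proof -
  have "std_normal_density g * exp (g\<^sup>2 / 4) = sqrt 2 * normal_density 0 (sqrt 2) g" for g
  proof -
    have "exp (- g\<^sup>2 / 2) * exp (g\<^sup>2 / 4) = exp (- g\<^sup>2 / 4)" by (simp add: exp_add[symmetric])
    moreover have "sqrt 2 * (1 / sqrt (2 * pi * (sqrt 2)\<^sup>2)) = 1 / sqrt (2 * pi)"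
      by (simp add: real_sqrt_mult real_sqrt_divide field_simps)
    ultimately show ?thesis
      by (simp add: normal_density_def field_simps)
  qed
  then have "(\<integral>\<^sup>+g. ennreal (std_normal_density g * exp (g\<^sup>2 / 4)) \<partial>lborel) =
      (\<integral>\<^sup>+g. ennreal (sqrt 2) * ennreal (normal_density 0 (sqrt 2) g) \<partial>lborel)"
    by (simp add: ennreal_mult)
  also have "\<dots> = ennreal (sqrt 2)"
    by (subst nn_integral_cmult) (simp_all add: nn_integral_normal_density)
  finally show ?thesis .
qed

text \<open>Linearisation: \<open>exp (b\<^sup>2 / 2)\<close> is the Gaussian average of \<open>exp (g * b)\<close>.\<close>

lemma subgaussian_exp_square:
  assumes "sigma_finite_measure N" and Y[measurable]: "Y \<in> borel_measurable N" and s: "0 < (s::real)"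
    and sub: "\<And>c::real. (\<integral>\<^sup>+z. ennreal (exp (c * Y z)) \<partial>N) \<le> ennreal (exp (c\<^sup>2 * s\<^sup>2 / 2))"
  shows "(\<integral>\<^sup>+z. ennreal (exp ((Y z)\<^sup>2 / (4 * s\<^sup>2))) \<partial>N) \<le> ennreal (sqrt 2)"
proof -
  interpret N: sigma_finite_measure N by fact
  interpret PS: pair_sigma_finite N lborel ..
  \<comment> \<open>\<open>r\<close> is chosen so that \<open>(r * Y z)\<^sup>2 / 2\<close> is the
    required exponent. Then \<open>r\<^sup>2 * s\<^sup>2 = 1 / 2\<close>, so the subgaussian bound
    costs only \<open>g\<^sup>2 / 4\<close>, which the Gaussian weight absorbs.\<close>
  define r where "r = 1 / (sqrt 2 * s)"
  have r2: "r\<^sup>2 = 1 / (2 * s\<^sup>2)" by (simp add: r_def power_divide power_mult_distrib)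
  have e: "exp ((Y z)\<^sup>2 / (4 * s\<^sup>2)) = exp ((r * Y z)\<^sup>2 / 2)" for z
    by (simp add: power_mult_distrib r2)
  have "(\<integral>\<^sup>+z. ennreal (exp ((Y z)\<^sup>2 / (4 * s\<^sup>2))) \<partial>N) =
      (\<integral>\<^sup>+z. (\<integral>\<^sup>+g. ennreal (std_normal_density g * exp (g * (r * Y z))) \<partial>lborel) \<partial>N)"
    unfolding e gaussian_mgf ..
  also have "\<dots> = (\<integral>\<^sup>+g. (\<integral>\<^sup>+z. ennreal (std_normal_density g * exp (g * (r * Y z))) \<partial>N) \<partial>lborel)"
    by (rule PS.Fubini'[symmetric]) measurable
  also have "\<dots> \<le> (\<integral>\<^sup>+g. ennreal (std_normal_density g * exp (g\<^sup>2 / 4)) \<partial>lborel)"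
  proof (rule nn_integral_mono)
    fix g
    have "(\<integral>\<^sup>+z. ennreal (std_normal_density g * exp (g * (r * Y z))) \<partial>N) =
        ennreal (std_normal_density g) * (\<integral>\<^sup>+z. ennreal (exp ((g * r) * Y z)) \<partial>N)"
      by (subst nn_integral_cmult[symmetric]) (simp_all add: ennreal_mult mult.assoc)
    also have "\<dots> \<le> ennreal (std_normal_density g) * ennreal (exp ((g * r)\<^sup>2 * s\<^sup>2 / 2))"
      by (intro mult_left_mono sub) simp
    also have "(g * r)\<^sup>2 * s\<^sup>2 / 2 = g\<^sup>2 / 4" using s by (simp add: power_mult_distrib r2)
    finally show "(\<integral>\<^sup>+z. ennreal (std_normal_density g * exp (g * (r * Y z))) \<partial>N) \<le>
        ennreal (std_normal_density g * exp (g\<^sup>2 / 4))"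
      by (simp add: ennreal_mult)
  qed
  also have "\<dots> = ennreal (sqrt 2)" by (rule gaussian_exp_square)
  finally show ?thesis .
qed

section \<open>Exponential moments of the generalization gap\<close>

lemma gen_gap_measurable:
  assumes "prob_space \<mu>z" and l: "(\<lambda>(w, z). l w z) \<in> borel_measurable (borel \<Otimes>\<^sub>M \<mu>z)"
  shows "(\<lambda>(S, w). gen_gap \<mu>z n l S w) \<in> borel_measurable (Pi\<^sub>M {..<n} (\<lambda>_. \<mu>z) \<Otimes>\<^sub>M borel)"
proof -
  interpret Z: prob_space \<mu>z by fact
  have "(\<lambda>w. \<integral>z. l w z \<partial>\<mu>z) \<in> borel_measurable borel"
    by (rule Z.borel_measurable_lebesgue_integral) (use l in simp)
  then have r: "(\<lambda>x. risk \<mu>z l (snd x)) \<in> borel_measurable (Pi\<^sub>M {..<n} (\<lambda>_. \<mu>z) \<Otimes>\<^sub>M borel)"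
    unfolding risk_def by (rule measurable_compose[OF measurable_snd])
  have "(\<lambda>x. l (snd x) (fst x i)) \<in> borel_measurable (Pi\<^sub>M {..<n} (\<lambda>_. \<mu>z) \<Otimes>\<^sub>M borel)"
    if i: "i \<in> {..<n}" for i
  proof -
    have "(\<lambda>x. (snd x, fst x i)) \<in> (Pi\<^sub>M {..<n} (\<lambda>_. \<mu>z) \<Otimes>\<^sub>M borel) \<rightarrow>\<^sub>M (borel \<Otimes>\<^sub>M \<mu>z)"
      by (intro measurable_Pair measurable_snd
          measurable_compose[OF measurable_fst measurable_component_singleton[OF i]])
    from measurable_compose[OF this l] show ?thesis by simp
  qed
  then have "(\<lambda>x. gen_gap \<mu>z n l (fst x) (snd x)) \<in> borel_measurable (Pi\<^sub>M {..<n} (\<lambda>_. \<mu>z) \<Otimes>\<^sub>M borel)"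
    unfolding gen_gap_def empirical_risk_def
    by (intro borel_measurable_diff r borel_measurable_divide borel_measurable_sum) auto
  then show ?thesis by (simp add: split_beta')
qed

text \<open>The exponential factors over the independent samples, each with parameter
  \<open>- c / n\<close>; the sign comes from risk minus loss. Multiplying the \<open>n\<close>
  bounds replaces \<Sigma> by \<open>\<Sigma> / sqrt n\<close>.\<close>

lemma gen_gap_subgaussian:
  assumes "prob_space \<mu>z" and n: "n \<ge> 1" and l: "(\<lambda>(w, z). l w z) \<in> borel_measurable (borel \<Otimes>\<^sub>M \<mu>z)"
    and sub: "subgaussian_loss \<mu>z l \<Sigma>"
  shows "(\<integral>\<^sup>+S. ennreal (exp (c * gen_gap \<mu>z n l S w)) \<partial>Pi\<^sub>M {..<n} (\<lambda>_. \<mu>z)) \<le>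
    ennreal (exp (c\<^sup>2 * (\<Sigma> / sqrt n)\<^sup>2 / 2))"
proof -
  interpret Z: prob_space \<mu>z by fact
  interpret PZ: product_sigma_finite "\<lambda>_::nat. \<mu>z" ..
  let ?f = "\<lambda>z. ennreal (exp ((- c / n) * (l w z - risk \<mu>z l w)))"
  have lw[measurable]: "l w \<in> borel_measurable \<mu>z"
    using measurable_compose[OF measurable_Pair1' l, of w] by simp
  have "ennreal (exp (c * gen_gap \<mu>z n l S w)) = (\<Prod>i\<in>{..<n}. ?f (S i))" for S
  proof -
    have "c * gen_gap \<mu>z n l S w = (\<Sum>i<n. (- c / n) * (l w (S i) - risk \<mu>z l w))"
      unfolding sum_distrib_left[symmetric] sum_subtractf gen_gap_def empirical_risk_def
      using n by (simp add: field_simps)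
    then show ?thesis by (simp add: exp_sum prod_ennreal)
  qed
  then have "(\<integral>\<^sup>+S. ennreal (exp (c * gen_gap \<mu>z n l S w)) \<partial>Pi\<^sub>M {..<n} (\<lambda>_. \<mu>z)) =
      (\<Prod>i\<in>{..<n}. integral\<^sup>N \<mu>z ?f)"
    by (simp only:) (rule PZ.product_nn_integral_prod, auto)
  also have "\<dots> \<le> (\<Prod>i\<in>{..<n}. ennreal (exp ((- c / n)\<^sup>2 * \<Sigma>\<^sup>2 / 2)))"
    using sub unfolding subgaussian_loss_def by (intro prod_mono_ennreal) blast
  also have "\<dots> = ennreal (exp ((- c / n)\<^sup>2 * \<Sigma>\<^sup>2 / 2) ^ n)" by (simp add: ennreal_power)
  also have "exp ((- c / n)\<^sup>2 * \<Sigma>\<^sup>2 / 2) ^ n = exp (c\<^sup>2 * (\<Sigma> / sqrt n)\<^sup>2 / 2)"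
    unfolding exp_of_nat_mult[symmetric] using n
    by (simp add: power_divide power2_eq_square[of "real n"] field_simps)
  finally show ?thesis .
qed

text \<open>Pointwise this is \<open>ln r \<le> r - 1\<close> at
  \<open>r = exp (h x) / (B * v x)\<close>, multiplied by \<open>v x\<close>. Since \<open>h\<close>
  is nonnegative, the same inequality is a domination and gives integrability.\<close>

lemma donsker_varadhan:
  fixes v h :: "'a \<Rightarrow> real"
  assumes h[measurable]: "h \<in> borel_measurable M" and hnn: "\<And>x. 0 \<le> h x"
    and vnn: "\<And>x. 0 \<le> v x" and v: "integrable M v" "(\<integral>x. v x \<partial>M) = 1"
    and ent: "integrable M (\<lambda>x. v x * ln (v x))"
    and B: "0 < B" "(\<integral>\<^sup>+x. ennreal (exp (h x)) \<partial>M) \<le> ennreal B"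
  shows "integrable M (\<lambda>x. v x * h x)"
    and "(\<integral>x. v x * h x \<partial>M) \<le> (\<integral>x. v x * ln (v x) \<partial>M) + ln B"
proof -
  have [measurable]: "v \<in> borel_measurable M" using v by auto
  have iexp: "integrable M (\<lambda>x. exp (h x))"
    using B by (intro integrableI_nonneg) (auto intro: le_less_trans)
  have Ie: "(\<integral>x. exp (h x) \<partial>M) \<le> B"
    using B nn_integral_eq_integral[OF iexp] by (simp add: ennreal_le_iff)
  let ?g = "\<lambda>x. v x * ln (v x) - v x + exp (h x) / B + v x * ln B"
  have le: "v x * h x \<le> ?g x" for x
  proof (cases "v x = 0")
    case False
    then have p: "0 < v x" using vnn[of x] by simp
    have "ln (exp (h x) / (B * v x)) \<le> exp (h x) / (B * v x) - 1"
      using p B by (intro ln_le_minus_one) auto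
    then have "v x * ln (exp (h x) / (B * v x)) \<le> v x * (exp (h x) / (B * v x) - 1)"
      using p by (intro mult_left_mono) auto
    moreover have "ln (exp (h x) / (B * v x)) = h x - ln B - ln (v x)"
      using p B by (simp add: ln_div ln_mult)
    moreover have "v x * (exp (h x) / (B * v x) - 1) = exp (h x) / B - v x"
      using p by (simp add: field_simps)
    ultimately show ?thesis by (simp add: algebra_simps)
  qed (use B in simp)
  have ig: "integrable M ?g" using ent v iexp by auto
  show i: "integrable M (\<lambda>x. v x * h x)"
    by (rule Bochner_Integration.integrable_bound[OF ig])
      (use le vnn hnn in \<open>auto intro!: AE_I2 order_trans[OF le abs_ge_self]\<close>)
  have "(\<integral>x. v x * h x \<partial>M) \<le> (\<integral>x. ?g x \<partial>M)" by (rule integral_mono[OF i ig le])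
  also have "\<dots> = (\<integral>x. v x * ln (v x) \<partial>M) - 1 + (\<integral>x. exp (h x) \<partial>M) / B + ln B"
    using ent v iexp by simp
  also have "(\<integral>x. exp (h x) \<partial>M) / B \<le> 1" using Ie B by simp
  finally show "(\<integral>x. v x * h x \<partial>M) \<le> (\<integral>x. v x * ln (v x) \<partial>M) + ln B" by simp
qed

text \<open>The variance of \<open>G\<close> under the probability measure with density
  \<open>v\<close> is nonnegative.\<close>

lemma integral_le_sqrt_second_moment:
  fixes v G :: "'a \<Rightarrow> real"
  assumes G[measurable]: "G \<in> borel_measurable M"
    and vnn: "\<And>x. 0 \<le> v x" and v: "integrable M v" "(\<integral>x. v x \<partial>M) = 1"
    and i: "integrable M (\<lambda>x. v x * (G x)\<^sup>2)"
  shows "integrable M (\<lambda>x. v x * G x)" "(\<integral>x. v x * G x \<partial>M) \<le> sqrt (\<integral>x. v x * (G x)\<^sup>2 \<partial>M)"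
proof -
  have [measurable]: "v \<in> borel_measurable M" using v by auto
  show iG: "integrable M (\<lambda>x. v x * G x)"
  proof (rule Bochner_Integration.integrable_bound[of M "\<lambda>x. v x + v x * (G x)\<^sup>2"])
    have "\<bar>v x * G x\<bar> \<le> \<bar>v x + v x * (G x)\<^sup>2\<bar>" for x
    proof -
      have "0 \<le> (\<bar>G x\<bar> - 1)\<^sup>2" "0 \<le> (G x)\<^sup>2" by simp_all
      then have "\<bar>G x\<bar> \<le> 1 + (G x)\<^sup>2" by (simp add: power2_diff)
      then have "v x * \<bar>G x\<bar> \<le> v x * (1 + (G x)\<^sup>2)" by (rule mult_left_mono) (rule vnn)
      then show ?thesis using vnn[of x] by (simp add: abs_mult distrib_left)
    qed
    then show "AE x in M. norm (v x * G x) \<le> norm (v x + v x * (G x)\<^sup>2)" by simp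
  qed (use v i in auto)
  define m where "m = (\<integral>x. v x * G x \<partial>M)"
  have "0 \<le> (\<integral>x. v x * (G x - m)\<^sup>2 \<partial>M)"
    using vnn by (intro integral_nonneg_AE AE_I2 mult_nonneg_nonneg) auto
  also have "(\<lambda>x. v x * (G x - m)\<^sup>2) = (\<lambda>x. v x * (G x)\<^sup>2 - 2 * m * (v x * G x) + m\<^sup>2 * v x)"
    by (auto simp: power2_eq_square algebra_simps)
  also have "(\<integral>x. v x * (G x)\<^sup>2 - 2 * m * (v x * G x) + m\<^sup>2 * v x \<partial>M) = (\<integral>x. v x * (G x)\<^sup>2 \<partial>M) - m\<^sup>2"
    using v i iG by (simp add: m_def[symmetric] power2_eq_square)
  finally show "(\<integral>x. v x * G x \<partial>M) \<le> sqrt (\<integral>x. v x * (G x)\<^sup>2 \<partial>M)"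
    unfolding m_def[symmetric] by (intro real_le_rsqrt) simp
qed

text \<open>The event is fixed before \<open>v\<close> is quantified. This order is what later
  permits densities that depend on \<open>S\<close> and run over all times.\<close>

lemma pac_bayes:
  fixes \<pi> :: "'a::topological_space measure"
  assumes Z: "prob_space \<mu>z" and n: "n \<ge> 1" and l: "(\<lambda>(w, z). l w z) \<in> borel_measurable (borel \<Otimes>\<^sub>M \<mu>z)"
    and sub: "subgaussian_loss \<mu>z l \<Sigma>" and \<Sigma>: "0 \<le> \<Sigma>" and \<zeta>: "0 < \<zeta>" "\<zeta> < 1"
    and pi: "prob_space \<pi>" and sets_pi: "sets \<pi> = sets borel"
  shows "\<exists>A\<in>sets (Pi\<^sub>M {..<n} (\<lambda>_. \<mu>z)). 1 - \<zeta> \<le> measure (Pi\<^sub>M {..<n} (\<lambda>_. \<mu>z)) A \<and>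
    (\<forall>S\<in>A. \<forall>v. integrable \<pi> v \<longrightarrow> (\<forall>x. 0 \<le> v x) \<longrightarrow> (\<integral>x. v x \<partial>\<pi>) = 1 \<longrightarrow>
      integrable \<pi> (\<lambda>x. v x * ln (v x)) \<longrightarrow>
      integrable \<pi> (\<lambda>x. v x * gen_gap \<mu>z n l S x) \<and>
      (\<integral>x. v x * gen_gap \<mu>z n l S x \<partial>\<pi>) \<le>
        2 * \<Sigma> / sqrt n * sqrt ((\<integral>x. v x * ln (v x) \<partial>\<pi>) + ln (3 / \<zeta>)))"
proof -
  interpret Z: prob_space \<mu>z by fact
  interpret pi: prob_space \<pi> by fact
  let ?N = "Pi\<^sub>M {..<n} (\<lambda>_. \<mu>z)"
  interpret N: prob_space ?N by (intro prob_space_PiM Z)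
  interpret PS: pair_sigma_finite ?N \<pi> ..
  define G where "G = gen_gap \<mu>z n l"
  have G[measurable]: "(\<lambda>(S, w). G S w) \<in> borel_measurable (?N \<Otimes>\<^sub>M \<pi>)"
    using gen_gap_measurable[OF Z l, of n]
    by (simp add: G_def measurable_cong_sets[OF sets_pair_measure_cong[OF refl sets_pi] refl])
  have Gw[measurable]: "(\<lambda>S. G S w) \<in> borel_measurable ?N" for w
    using measurable_compose[OF measurable_Pair2' G, of w] sets_eq_imp_space_eq[OF sets_pi] by simp
  have GS: "G S \<in> borel_measurable \<pi>" if "S \<in> space ?N" for S
    using measurable_compose[OF measurable_Pair1'[OF that] G] by simp
  have square: "(\<integral>\<^sup>+S. (\<integral>\<^sup>+w. ennreal (exp ((G S w)\<^sup>2 / (4 * s\<^sup>2))) \<partial>\<pi>) \<partial>?N) \<le> ennreal (sqrt 2)"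
    if s: "0 < s" "\<Sigma> / sqrt n \<le> s" for s
  proof -
    have "(\<integral>\<^sup>+S. (\<integral>\<^sup>+w. ennreal (exp ((G S w)\<^sup>2 / (4 * s\<^sup>2))) \<partial>\<pi>) \<partial>?N) =
        (\<integral>\<^sup>+w. (\<integral>\<^sup>+S. ennreal (exp ((G S w)\<^sup>2 / (4 * s\<^sup>2))) \<partial>?N) \<partial>\<pi>)"
      by (rule PS.Fubini'[symmetric]) measurable
    also have "\<dots> \<le> (\<integral>\<^sup>+w. ennreal (sqrt 2) \<partial>\<pi>)"
    proof (intro nn_integral_mono subgaussian_exp_square s Gw)
      show "sigma_finite_measure ?N" ..
      show "(\<integral>\<^sup>+S. ennreal (exp (c * G S w)) \<partial>?N) \<le> ennreal (exp (c\<^sup>2 * s\<^sup>2 / 2))" for c w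
      proof -
        have "(\<Sigma> / sqrt n)\<^sup>2 \<le> s\<^sup>2" using s \<Sigma> by (intro power_mono) auto
        then have "c\<^sup>2 * (\<Sigma> / sqrt n)\<^sup>2 / 2 \<le> c\<^sup>2 * s\<^sup>2 / 2"
          by (intro divide_right_mono mult_left_mono) auto
        then show ?thesis
          by (intro order_trans[OF gen_gap_subgaussian[OF Z n l sub, folded G_def]] ennreal_leI) simp
      qed
    qed
    also have "\<dots> = ennreal (sqrt 2)" by (simp add: pi.emeasure_space_1)
    finally show ?thesis .
  qed
  show ?thesis
  proof (cases "\<Sigma> = 0")
    case True
    have "(\<integral>\<^sup>+S. (\<integral>\<^sup>+w. ennreal ((G S w)\<^sup>2) \<partial>\<pi>) \<partial>?N) \<le> 0 + ennreal e" if e: "0 < e" for e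
    proof -
      \<comment> \<open>\<open>s\<close> solves \<open>4 * s\<^sup>2 * sqrt 2 = e\<close>. With y
        \<le> exp y, \<open>square\<close> becomes a bound \<open>e\<close> on the second moment of
        the gap; as \<open>e\<close> is arbitrary, the gap vanishes almost everywhere, matching the
        right-hand side 0.\<close>
      define s where "s = sqrt (e / (4 * sqrt 2))"
      have s: "0 < s" "4 * s\<^sup>2 * sqrt 2 = e" using e by (simp_all add: s_def)
      have "(\<integral>\<^sup>+S. (\<integral>\<^sup>+w. ennreal ((G S w)\<^sup>2) \<partial>\<pi>) \<partial>?N) \<le>
          (\<integral>\<^sup>+S. (\<integral>\<^sup>+w. ennreal (4 * s\<^sup>2) * ennreal (exp ((G S w)\<^sup>2 / (4 * s\<^sup>2))) \<partial>\<pi>) \<partial>?N)"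
      proof (intro nn_integral_mono)
        fix S w
        have "(G S w)\<^sup>2 / (4 * s\<^sup>2) \<le> exp ((G S w)\<^sup>2 / (4 * s\<^sup>2))"
          using exp_ge_add_one_self[of "(G S w)\<^sup>2 / (4 * s\<^sup>2)"] by linarith
        then have "(G S w)\<^sup>2 \<le> 4 * s\<^sup>2 * exp ((G S w)\<^sup>2 / (4 * s\<^sup>2))"
          using s by (simp add: pos_divide_le_eq mult.commute)
        then show "ennreal ((G S w)\<^sup>2) \<le> ennreal (4 * s\<^sup>2) * ennreal (exp ((G S w)\<^sup>2 / (4 * s\<^sup>2)))"
          by (subst ennreal_mult[symmetric]) (auto intro: ennreal_leI)
      qed
      also have "\<dots> = (\<integral>\<^sup>+S. ennreal (4 * s\<^sup>2) * (\<integral>\<^sup>+w. ennreal (exp ((G S w)\<^sup>2 / (4 * s\<^sup>2))) \<partial>\<pi>) \<partial>?N)"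
        using GS by (intro nn_integral_cong nn_integral_cmult) simp
      also have "\<dots> = ennreal (4 * s\<^sup>2) * (\<integral>\<^sup>+S. (\<integral>\<^sup>+w. ennreal (exp ((G S w)\<^sup>2 / (4 * s\<^sup>2))) \<partial>\<pi>) \<partial>?N)"
        by (intro nn_integral_cmult) measurable
      also have "\<dots> \<le> ennreal (4 * s\<^sup>2) * ennreal (sqrt 2)"
        using s True by (intro mult_left_mono square) auto
      also have "\<dots> = ennreal e" using s by (subst ennreal_mult[symmetric]) auto
      finally show ?thesis by simp
    qed
    then have "(\<integral>\<^sup>+S. (\<integral>\<^sup>+w. ennreal ((G S w)\<^sup>2) \<partial>\<pi>) \<partial>?N) \<le> 0" by (rule ennreal_le_epsilon)
    then have "(\<integral>\<^sup>+S. (\<integral>\<^sup>+w. ennreal ((G S w)\<^sup>2) \<partial>\<pi>) \<partial>?N) = 0" by simp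
    then have AE: "AE S in ?N. (\<integral>\<^sup>+w. ennreal ((G S w)\<^sup>2) \<partial>\<pi>) = 0"
      by (subst (asm) nn_integral_0_iff_AE) measurable
    define A where "A = {S \<in> space ?N. (\<integral>\<^sup>+w. ennreal ((G S w)\<^sup>2) \<partial>\<pi>) = 0}"
    have A: "A \<in> sets ?N" unfolding A_def by measurable
    have "measure ?N A = 1" using AE unfolding A_def by (intro N.prob_Collect_eq_1[THEN iffD2]) measurable
    moreover have "integrable \<pi> (\<lambda>x. v x * G S x) \<and> (\<integral>x. v x * G S x \<partial>\<pi>) \<le> 0"
      if S: "S \<in> A" and v: "integrable \<pi> v" for S v
    proof -
      have [measurable]: "G S \<in> borel_measurable \<pi>" "v \<in> borel_measurable \<pi>"
        using S v by (auto simp: A_def intro: GS)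
      have "AE w in \<pi>. ennreal ((G S w)\<^sup>2) = 0"
        using S by (subst nn_integral_0_iff_AE[symmetric]) (auto simp: A_def)
      then have z: "AE w in \<pi>. v w * G S w = 0" by eventually_elim (simp add: ennreal_eq_0_iff)
      have "integrable \<pi> (\<lambda>x. v x * G S x)" by (subst integrable_cong_AE[OF _ _ z]) auto
      moreover have "(\<integral>x. v x * G S x \<partial>\<pi>) = (\<integral>x. 0 \<partial>\<pi>)" by (rule integral_cong_AE[OF _ _ z]) auto
      ultimately show ?thesis by simp
    qed
    ultimately show ?thesis using A \<zeta> True unfolding G_def by (intro bexI[of _ A]) auto
  next
    case False
    define s where "s = \<Sigma> / sqrt n"
    have s: "0 < s" using False \<Sigma> n by (simp add: s_def)
    define E where "E S = (\<integral>\<^sup>+w. ennreal (exp ((G S w)\<^sup>2 / (4 * s\<^sup>2))) \<partial>\<pi>)" for S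
    have E[measurable]: "E \<in> borel_measurable ?N" unfolding E_def by measurable
    \<comment> \<open>The mean of \<open>E\<close> is at most \<open>sqrt 2\<close>, so Markov's
      inequality at the threshold \<open>3 / \<zeta>\<close> leaves failure probability at most
      \<open>\<zeta> * (sqrt 2 / 3)\<close>, below \<zeta>.\<close>
    define A where "A = {S \<in> space ?N. E S \<le> ennreal (3 / \<zeta>)}"
    have A[measurable]: "A \<in> sets ?N" unfolding A_def by measurable
    have "emeasure ?N (space ?N - A) \<le> ennreal \<zeta>"
    proof -
      have sub: "space ?N - A \<subseteq> {S \<in> space ?N. 1 \<le> ennreal (\<zeta> / 3) * E S}"
      proof (intro subsetI CollectI conjI)
        fix S assume S: "S \<in> space ?N - A"
        then have "ennreal (3 / \<zeta>) \<le> E S" by (auto simp: A_def)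
        then have "ennreal (\<zeta> / 3) * ennreal (3 / \<zeta>) \<le> ennreal (\<zeta> / 3) * E S" by (intro mult_left_mono) auto
        then show "1 \<le> ennreal (\<zeta> / 3) * E S" using \<zeta> by (simp add: ennreal_mult[symmetric])
      qed auto
      have "emeasure ?N (space ?N - A) \<le> ennreal (\<zeta> / 3) * (\<integral>\<^sup>+S. E S * indicator (space ?N) S \<partial>?N)"
      proof (rule order_trans[OF emeasure_mono[OF sub]])
        show "emeasure ?N {S \<in> space ?N. 1 \<le> ennreal (\<zeta> / 3) * E S} \<le>
            ennreal (\<zeta> / 3) * (\<integral>\<^sup>+S. E S * indicator (space ?N) S \<partial>?N)"
          by (rule nn_integral_Markov_inequality) measurable
      qed measurable
      also have "(\<integral>\<^sup>+S. E S * indicator (space ?N) S \<partial>?N) = (\<integral>\<^sup>+S. E S \<partial>?N)"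
        by (intro nn_integral_cong) simp
      also have "ennreal (\<zeta> / 3) * (\<integral>\<^sup>+S. E S \<partial>?N) \<le> ennreal (\<zeta> / 3) * ennreal (sqrt 2)"
        unfolding E_def using s by (intro mult_left_mono square) (auto simp: s_def)
      also have "ennreal (\<zeta> / 3) * ennreal (sqrt 2) = ennreal (\<zeta> * (sqrt 2 / 3))"
        using \<zeta> by (subst ennreal_mult[symmetric]) auto
      also have "\<dots> \<le> ennreal \<zeta>"
      proof (rule ennreal_leI)
        have "sqrt 2 / 3 \<le> 1" using sqrt2_less_2 by simp
        then show "\<zeta> * (sqrt 2 / 3) \<le> \<zeta>" using \<zeta> mult_left_mono[of "sqrt 2 / 3" 1 \<zeta>] by simp
      qed
      finally show ?thesis .
    qed
    then have "1 - measure ?N A \<le> \<zeta>"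
      using \<zeta> by (simp add: N.emeasure_eq_measure N.prob_compl ennreal_le_iff)
    moreover have "integrable \<pi> (\<lambda>x. v x * G S x) \<and>
        (\<integral>x. v x * G S x \<partial>\<pi>) \<le> 2 * \<Sigma> / sqrt n * sqrt ((\<integral>x. v x * ln (v x) \<partial>\<pi>) + ln (3 / \<zeta>))"
      if S: "S \<in> A" and v: "integrable \<pi> v" "\<And>x. 0 \<le> v x" "(\<integral>x. v x \<partial>\<pi>) = 1"
        "integrable \<pi> (\<lambda>x. v x * ln (v x))" for S v
    proof -
      have GS'[measurable]: "G S \<in> borel_measurable \<pi>" using S by (auto simp: A_def intro: GS)
      have b: "(\<integral>\<^sup>+w. ennreal (exp ((G S w)\<^sup>2 / (4 * s\<^sup>2))) \<partial>\<pi>) \<le> ennreal (3 / \<zeta>)"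
        using S by (simp add: A_def E_def)
      have h: "(\<lambda>w. (G S w)\<^sup>2 / (4 * s\<^sup>2)) \<in> borel_measurable \<pi>" by measurable
      have hnn: "0 \<le> (G S w)\<^sup>2 / (4 * s\<^sup>2)" for w by simp
      have B: "0 < 3 / \<zeta>" using \<zeta> by simp
      note dv = donsker_varadhan[OF h hnn v(2,1,3,4) B b]
      have eq: "v x * (G S x)\<^sup>2 = 4 * s\<^sup>2 * (v x * ((G S x)\<^sup>2 / (4 * s\<^sup>2)))" for x
        using s by simp
      have i: "integrable \<pi> (\<lambda>x. v x * (G S x)\<^sup>2)" unfolding eq by (intro integrable_mult_right dv)
      have "(\<integral>x. v x * (G S x)\<^sup>2 \<partial>\<pi>) = 4 * s\<^sup>2 * (\<integral>x. v x * ((G S x)\<^sup>2 / (4 * s\<^sup>2)) \<partial>\<pi>)"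
        unfolding eq by (rule integral_mult_right_zero)
      also have "\<dots> \<le> 4 * s\<^sup>2 * ((\<integral>x. v x * ln (v x) \<partial>\<pi>) + ln (3 / \<zeta>))"
        by (intro mult_left_mono dv) simp
      finally have "sqrt (\<integral>x. v x * (G S x)\<^sup>2 \<partial>\<pi>) \<le> sqrt (4 * s\<^sup>2 * ((\<integral>x. v x * ln (v x) \<partial>\<pi>) + ln (3 / \<zeta>)))"
        by (rule real_sqrt_le_mono)
      \<comment> \<open>The constant is the square root of \<open>4 * s\<^sup>2\<close> with
        \<open>s = \<Sigma> / sqrt n\<close>.\<close>
      also have "\<dots> = 2 * \<Sigma> / sqrt n * sqrt ((\<integral>x. v x * ln (v x) \<partial>\<pi>) + ln (3 / \<zeta>))"
        using s \<Sigma> by (simp add: real_sqrt_mult s_def)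
      finally show ?thesis
        using integral_le_sqrt_second_moment[OF GS' v(2,1,3) i] by auto
    qed
    ultimately show ?thesis using A unfolding G_def by (intro bexI[of _ A] conjI) auto
  qed
qed

subsection \<open>Entropy of the Poissonized chain\<close>

lemma dens_measurable[measurable]: "dens \<pi> \<mu> \<in> borel_measurable \<pi>"
  unfolding dens_def[abs_def] by measurable

lemma dens_nonneg: "0 \<le> dens \<pi> \<mu> x"
  by (simp add: dens_def)

text \<open>For nonnegative \<open>f\<close> the second term of \<open>dual_op\<close> starts from
  the truncated density of \<open>- f\<close>, which gives the null measure. The kernel keeps it
  null, so its derivative vanishes almost everywhere.\<close>

lemma dual_op_nonneg:
  fixes K :: "'a::topological_space \<Rightarrow> 'a measure"
  assumes pi: "prob_space \<pi>" and sets_pi: "sets \<pi> = sets borel" and K: "K \<in> borel \<rightarrow>\<^sub>M subprob_algebra borel"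
    and f: "f \<in> borel_measurable borel" "\<And>x. 0 \<le> f x"
  shows "AE x in \<pi>. dual_op \<pi> K f x = dens \<pi> (bind (density \<pi> (\<lambda>y. ennreal (f y))) K) x"
proof -
  interpret prob_space \<pi> by fact
  let ?z = "bind (density \<pi> (\<lambda>y. ennreal (- f y))) K"
  have K': "K \<in> density \<pi> (\<lambda>y. ennreal (- f y)) \<rightarrow>\<^sub>M subprob_algebra borel"
    using K by (simp add: measurable_density_eq1 measurable_cong_sets[OF sets_pi refl])
  have s: "sets ?z = sets borel"
    using sets_kernel[OF K] sets_eq_imp_space_eq[OF sets_pi] by (subst sets_bind[where N=borel]) auto
  have "density \<pi> (\<lambda>_. 0) = ?z"
  proof (rule measure_eqI)
    fix A assume "A \<in> sets (density \<pi> (\<lambda>_. 0))"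
    then have A: "A \<in> sets borel" by (simp add: sets_pi)
    have "density \<pi> (\<lambda>y. ennreal (- f y)) = density \<pi> (\<lambda>_. 0)"
      using f by (intro density_cong) (auto simp: measurable_cong_sets[OF sets_pi refl] ennreal_neg)
    then have "emeasure ?z A = (\<integral>\<^sup>+x. emeasure (K x) A \<partial>density \<pi> (\<lambda>_. 0))"
      using emeasure_bind[OF _ K' A] sets_eq_imp_space_eq[OF sets_pi] by simp
    also have "\<dots> = 0"
    proof (subst nn_integral_density)
      show "(\<lambda>x. emeasure (K x) A) \<in> borel_measurable \<pi>"
        using measurable_compose[OF K measurable_emeasure_subprob_algebra[OF A]]
        by (simp add: measurable_cong_sets[OF sets_pi refl])
    qed auto
    finally show "emeasure (density \<pi> (\<lambda>_. 0)) A = emeasure ?z A"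
      using A by (simp add: emeasure_density sets_pi)
  qed (simp add: s sets_pi)
  from RN_deriv_unique[OF _ this] have "AE x in \<pi>. RN_deriv \<pi> ?z x = 0" by auto
  then show ?thesis by eventually_elim (simp add: dual_op_def dens_def)
qed

lemma dens_density:
  assumes "sigma_finite_measure \<pi>" "f \<in> borel_measurable \<pi>" "\<And>x. 0 \<le> f x" "density \<pi> (\<lambda>x. ennreal (f x)) = \<mu>"
  shows "AE x in \<pi>. dens \<pi> \<mu> x = f x"
proof -
  interpret sigma_finite_measure \<pi> by fact
  have "AE x in \<pi>. ennreal (f x) = RN_deriv \<pi> \<mu> x" by (rule RN_deriv_unique) (use assms in auto)
  then show ?thesis
  proof eventually_elim
    case (elim x)
    then show ?case using assms(3)[of x] by (simp add: dens_def elim[symmetric])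
  qed
qed

text \<open>\<open>enn2real\<close> alters only the value infinity, which the derivative of a finite
  measure takes on a null set.\<close>

lemma density_dens:
  assumes "prob_space \<pi>" "prob_space \<mu>" "absolutely_continuous \<pi> \<mu>" "sets \<mu> = sets \<pi>"
  shows "density \<pi> (\<lambda>x. ennreal (dens \<pi> \<mu> x)) = \<mu>"
proof -
  interpret prob_space \<pi> by fact
  interpret m: prob_space \<mu> by fact
  have "sigma_finite_measure \<mu>" ..
  from RN_deriv_finite[OF this assms(3,4)]
  have "density \<pi> (\<lambda>x. ennreal (dens \<pi> \<mu> x)) = density \<pi> (RN_deriv \<pi> \<mu>)"
    by (intro density_cong) (auto simp: dens_def less_top)
  then show ?thesis using density_RN_deriv[OF assms(3,4)] by simp
qed

text \<open>To base \<open>exp 1\<close> the entropy density is \<open>ln\<close> of the density,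
  and the change of measure brings \<open>dens \<pi> \<mu> x\<close> into the integrand.\<close>

lemma KL_finiteD:
  assumes pi: "prob_space \<pi>" and mu: "prob_space \<mu>" "sets \<mu> = sets \<pi>" and fin: "KL \<mu> \<pi> < \<infinity>"
  shows "integrable \<pi> (\<lambda>x. dens \<pi> \<mu> x * ln (dens \<pi> \<mu> x))"
    and "real_of_ereal (KL \<mu> \<pi>) = (\<integral>x. dens \<pi> \<mu> x * ln (dens \<pi> \<mu> x) \<partial>\<pi>)"
proof -
  have ac: "absolutely_continuous \<pi> \<mu>" and i: "integrable \<mu> (entropy_density (exp 1) \<pi> \<mu>)"
    and K: "real_of_ereal (KL \<mu> \<pi>) = (\<integral>x. entropy_density (exp 1) \<pi> \<mu> x \<partial>\<mu>)"
    using fin by (auto simp: KL_def KL_divergence_def split: if_splits)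
  have e: "entropy_density (exp 1) \<pi> \<mu> = (\<lambda>x. ln (dens \<pi> \<mu> x))"
    by (auto simp: entropy_density_def dens_def log_def)
  have d: "density \<pi> (\<lambda>x. ennreal (dens \<pi> \<mu> x)) = \<mu>" by (rule density_dens) fact+
  have nn: "AE x in \<pi>. 0 \<le> dens \<pi> \<mu> x" by (simp add: dens_def)
  have m: "(\<lambda>x. ln (dens \<pi> \<mu> x)) \<in> borel_measurable \<pi>" by measurable
  have "integrable (density \<pi> (\<lambda>x. ennreal (dens \<pi> \<mu> x))) (\<lambda>x. ln (dens \<pi> \<mu> x))"
    unfolding d using i by (simp add: e)
  then show "integrable \<pi> (\<lambda>x. dens \<pi> \<mu> x * ln (dens \<pi> \<mu> x))"
    by (subst (asm) integrable_real_density) (use m nn in auto)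
  have "real_of_ereal (KL \<mu> \<pi>) = (\<integral>x. ln (dens \<pi> \<mu> x) \<partial>density \<pi> (\<lambda>x. ennreal (dens \<pi> \<mu> x)))"
    unfolding d K e ..
  also have "\<dots> = (\<integral>x. dens \<pi> \<mu> x * ln (dens \<pi> \<mu> x) \<partial>\<pi>)"
    by (rule integral_real_density) (use m nn in auto)
  finally show "real_of_ereal (KL \<mu> \<pi>) = (\<integral>x. dens \<pi> \<mu> x * ln (dens \<pi> \<mu> x) \<partial>\<pi>)" .
qed

text \<open>For each natural \<open>m\<close> the integrated series is exp m, so the series is
  finite almost everywhere; countably many \<open>m\<close> dominate all real \<open>t\<close>. On
  the exceptional null set every density is replaced by the constant \<open>c\<close>, whose series
  is exponential.\<close>

lemma regular_densities:
  fixes \<mu> :: "nat \<Rightarrow> 'a::topological_space measure"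
  assumes pi: "prob_space \<pi>" and sets_pi: "sets \<pi> = sets borel"
    and mu: "\<And>k. prob_space (\<mu> k)" "\<And>k. sets (\<mu> k) = sets borel" "\<And>k. absolutely_continuous \<pi> (\<mu> k)"
    and c: "0 < c" "AE x in \<pi>. c \<le> dens \<pi> (\<mu> 0) x"
  obtains u :: "nat \<Rightarrow> 'a \<Rightarrow> real" where
    "\<And>k. u k \<in> borel_measurable borel" "\<And>k x. 0 \<le> u k x" "\<And>x. c \<le> u 0 x"
    "\<And>(t::real) x. summable (\<lambda>k. u k x / fact k * t ^ k)"
    "\<And>k. density \<pi> (\<lambda>x. ennreal (u k x)) = \<mu> k"
proof -
  interpret prob_space \<pi> by fact
  define g where "g k = dens \<pi> (\<mu> k)" for k
  have [measurable]: "g k \<in> borel_measurable \<pi>" for k by (simp add: g_def)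
  have gnn: "0 \<le> g k x" for k x by (simp add: g_def dens_nonneg)
  have gd: "density \<pi> (\<lambda>x. ennreal (g k x)) = \<mu> k" for k
    unfolding g_def by (rule density_dens) (use mu pi sets_pi in auto)
  have g1: "(\<integral>\<^sup>+x. ennreal (g k x) \<partial>\<pi>) = 1" for k
  proof -
    have "emeasure (density \<pi> (\<lambda>x. ennreal (g k x))) (space \<pi>) = 1"
      unfolding gd using prob_space.emeasure_space_1[OF mu(1)[of k]] sets_eq_imp_space_eq[OF mu(2)[of k]]
        sets_eq_imp_space_eq[OF sets_pi] by simp
    then show ?thesis by (subst (asm) emeasure_density) (auto cong: nn_integral_cong_simp)
  qed
  have fin: "AE x in \<pi>. (\<Sum>k. ennreal (g k x / fact k * real m ^ k)) \<noteq> \<infinity>" for m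
  proof (rule nn_integral_noteq_infinite)
    have "(\<integral>\<^sup>+x. (\<Sum>k. ennreal (g k x / fact k * real m ^ k)) \<partial>\<pi>) =
        (\<Sum>k. \<integral>\<^sup>+x. ennreal (g k x / fact k * real m ^ k) \<partial>\<pi>)"
      by (rule nn_integral_suminf) measurable
    also have "\<dots> = (\<Sum>k. ennreal (real m ^ k / fact k))"
    proof (rule suminf_cong)
      fix k
      have "ennreal (g k x / fact k * real m ^ k) = ennreal (real m ^ k / fact k) * ennreal (g k x)" for x
        using gnn by (subst ennreal_mult[symmetric]) (auto simp: mult.commute)
      then show "(\<integral>\<^sup>+x. ennreal (g k x / fact k * real m ^ k) \<partial>\<pi>) = ennreal (real m ^ k / fact k)"
        by (simp add: nn_integral_cmult g1)
    qed
    also have "\<dots> \<noteq> \<infinity>"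
      using summable_exp[of "real m"] by (simp add: suminf_ennreal2 divide_inverse_commute)
    finally show "(\<integral>\<^sup>+x. (\<Sum>k. ennreal (g k x / fact k * real m ^ k)) \<partial>\<pi>) \<noteq> \<infinity>" .
  qed measurable
  define R where "R x \<longleftrightarrow> c \<le> g 0 x \<and> (\<forall>m::nat. (\<Sum>k. ennreal (g k x / fact k * real m ^ k)) \<noteq> \<infinity>)" for x
  have [measurable]: "Measurable.pred \<pi> R" unfolding R_def by measurable
  have AE_R: "AE x in \<pi>. R x"
    unfolding R_def using c(2) fin by (simp add: AE_all_countable g_def)
  define u where "u k x = (if R x then g k x else c)" for k x
  show thesis
  proof
    show "u k \<in> borel_measurable borel" for k
      unfolding u_def[abs_def] measurable_cong_sets[OF sets_pi refl, symmetric] by measurable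
    show "0 \<le> u k x" for k x using gnn c by (simp add: u_def)
    show "c \<le> u 0 x" for x by (simp add: u_def R_def)
    show "summable (\<lambda>k. u k x / fact k * t ^ k)" for t :: real and x
    proof (cases "R x")
      case True
      obtain m :: nat where m: "\<bar>t\<bar> \<le> real m" using real_arch_simple by blast
      have "(\<Sum>k. ennreal (g k x / fact k * real m ^ k)) \<noteq> \<infinity>" using True by (simp add: R_def)
      then have s: "summable (\<lambda>k. g k x / fact k * real m ^ k)"
        using gnn by (intro summable_suminf_not_top) auto
      show ?thesis
      proof (rule summable_comparison_test'[OF s])
        fix k
        have "\<bar>t\<bar> ^ k \<le> real m ^ k" using m by (intro power_mono) auto
        then have "g k x / fact k * \<bar>t\<bar> ^ k \<le> g k x / fact k * real m ^ k"
          using gnn by (intro mult_left_mono) auto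
        then show "norm (u k x / fact k * t ^ k) \<le> g k x / fact k * real m ^ k"
          using True gnn by (simp add: u_def abs_mult power_abs)
      qed
    next
      case False
      have "summable (\<lambda>k. c * (inverse (fact k) * t ^ k))" by (intro summable_mult summable_exp)
      then show ?thesis using False by (simp add: u_def divide_inverse mult.assoc)
    qed
    show "density \<pi> (\<lambda>x. ennreal (u k x)) = \<mu> k" for k
      unfolding gd[of k, symmetric]
    proof (rule density_cong)
      show "AE x in \<pi>. ennreal (u k x) = ennreal (g k x)"
        using AE_R by eventually_elim (simp add: u_def)
      show "(\<lambda>x. ennreal (u k x)) \<in> borel_measurable \<pi>"
        unfolding u_def by measurable
    qed measurable
  qed
qed

text \<open>The \<open>v\<close> obtained is a version of the densities that is regular at every
  point and fits \<open>poisson_density_flow\<close>. The conclusions about the expansion term are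
  carried back to \<open>dens\<close> by almost-everywhere equality.\<close>

lemma poissonized_flow:
  fixes M :: "'w measure" and \<pi> \<mu>0 :: "'a::topological_space measure"
  assumes M: "prob_space M" and K: "K \<in> borel \<rightarrow>\<^sub>M prob_algebra borel" and X: "markov_chain M K \<mu>0 X"
    and N: "poisson_process M 1 N" and ind: "indep_processes M X N"
    and P: "P \<in> borel \<rightarrow>\<^sub>M prob_algebra borel"
    and pi: "\<pi> \<in> space (prob_algebra borel)" and inv: "bind \<pi> P = \<pi>"
    and ac0: "absolutely_continuous \<pi> \<mu>0" and KL: "KL \<mu>0 \<pi> < \<infinity>"
    and lower: "\<exists>c>0. AE x in \<pi>. c \<le> dens \<pi> \<mu>0 x"
    and acK: "\<And>\<mu>. \<mu> \<in> space (prob_algebra borel) \<Longrightarrow> absolutely_continuous \<pi> \<mu> \<Longrightarrow>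
      absolutely_continuous \<pi> (bind \<mu> K)"
    and ent: "\<And>t. 0 \<le> t \<Longrightarrow> integrable \<pi> (\<lambda>x. dual_op \<pi> K (dens \<pi> (poissonized_law M X N t)) x *
      ln (dual_op \<pi> K (dens \<pi> (poissonized_law M X N t)) x))"
  obtains v where
    "\<And>t x. 0 \<le> t \<Longrightarrow> 0 \<le> v t x" "\<And>t. 0 \<le> t \<Longrightarrow> integrable \<pi> (v t)" "\<And>t. 0 \<le> t \<Longrightarrow> (\<integral>x. v t x \<partial>\<pi>) = 1"
    "\<And>t. 0 \<le> t \<Longrightarrow> integrable \<pi> (\<lambda>x. v t x * ln (v t x))"
    "\<And>t. 0 \<le> t \<Longrightarrow> density \<pi> (\<lambda>x. ennreal (v t x)) = poissonized_law M X N t"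
    "\<And>t. 0 \<le> t \<Longrightarrow> expansion_defined \<pi> P K (dens \<pi> (poissonized_law M X N t))"
    "\<And>T. 0 \<le> T \<Longrightarrow> set_integrable lborel {0..T}
      (\<lambda>t. expansion_term \<pi> P K (dens \<pi> (poissonized_law M X N t)))"
    "\<And>T. 0 \<le> T \<Longrightarrow> (\<integral>x. v T x * ln (v T x) \<partial>\<pi>) \<le> real_of_ereal (KL \<mu>0 \<pi>) +
      (LINT t:{0..T}|lborel. expansion_term \<pi> P K (dens \<pi> (poissonized_law M X N t)))"
proof -
  interpret M: prob_space M by fact
  interpret pi: prob_space \<pi> using pi by (simp add: space_prob_algebra)
  have sp: "sets \<pi> = sets borel" using pi by (simp add: space_prob_algebra)
  have Xm[measurable]: "X k \<in> borel_measurable M" for k using X by (simp add: markov_chain_def)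
  define \<mu> where "\<mu> k = distr M borel (X k)" for k
  have mu0: "\<mu> 0 = \<mu>0" using X by (simp add: markov_chain_def \<mu>_def)
  have muS: "\<mu> (Suc k) = bind (\<mu> k) K" for k unfolding \<mu>_def by (rule markov_chain_step[OF M K X])
  have mu: "prob_space (\<mu> k)" "sets (\<mu> k) = sets borel" for k
    unfolding \<mu>_def by (auto intro!: M.prob_space_distr)
  have ac: "absolutely_continuous \<pi> (\<mu> k)" for k
  proof (induction k)
    case (Suc k)
    then show ?case unfolding muS using mu by (intro acK) (auto simp: space_prob_algebra)
  qed (simp add: mu0 ac0)
  obtain c where c: "0 < c" "AE x in \<pi>. c \<le> dens \<pi> (\<mu> 0) x" using lower mu0 by auto
  obtain u where u: "\<And>k. u k \<in> borel_measurable borel" "\<And>k x. 0 \<le> u k x" "\<And>x. c \<le> u 0 x"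
    "\<And>(t::real) x. summable (\<lambda>k. u k x / fact k * t ^ k)"
    "\<And>k. density \<pi> (\<lambda>x. ennreal (u k x)) = \<mu> k"
    using regular_densities[of \<pi> \<mu> c, OF pi.prob_space_axioms sp mu ac c] by blast
  note [measurable] = u(1)
  have um[measurable]: "u k \<in> borel_measurable \<pi>" for k using u(1) by (simp add: measurable_cong_sets[OF sp refl])
  have us: "summable (\<lambda>k. u (Suc k) x / fact k * t ^ k)" for x and t :: real
    using termdiff_converges_all[of "\<lambda>k. u k x / fact k" t] u(4)
    by (simp add: diffs_def field_simps del: of_nat_Suc)
  define \<rho> where "\<rho> = poissonized_law M X N"
  define v where "v t x = exp (- t) * (\<Sum>k. u k x / fact k * t ^ k)" for t x
  define q where "q t x = exp (- t) * (\<Sum>k. u (Suc k) x / fact k * t ^ k)" for t x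
  have vq[measurable]: "v t \<in> borel_measurable borel" "q t \<in> borel_measurable borel" for t
    unfolding v_def q_def by measurable
  have vq'[measurable]: "v t \<in> borel_measurable \<pi>" "q t \<in> borel_measurable \<pi>" for t
    using vq by (simp_all add: measurable_cong_sets[OF sp refl])
  have vnn: "0 \<le> v t x" "0 \<le> q t x" if "0 \<le> t" for t x
    unfolding v_def q_def using that
    by (intro mult_nonneg_nonneg suminf_nonneg us u(2,4) divide_nonneg_nonneg; simp)+
  have K': "K \<in> borel \<rightarrow>\<^sub>M subprob_algebra borel" "P \<in> borel \<rightarrow>\<^sub>M subprob_algebra borel"
    using K P by (auto intro: measurable_prob_algebraD)
  have Kd: "K \<in> L \<rightarrow>\<^sub>M subprob_algebra borel" if "sets L = sets borel" for L
    using K'(1) by (simp add: measurable_cong_sets[OF that refl])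
  have mix: "(\<integral>\<^sup>+x. ennreal (exp (- t) * (\<Sum>k. w k x / fact k * t ^ k)) * f x \<partial>\<pi>) =
      (\<Sum>k. ennreal (exp (- t) * t ^ k / fact k) * (\<integral>\<^sup>+x. ennreal (w k x) * f x \<partial>\<pi>))"
    if "0 \<le> t" "f \<in> borel_measurable \<pi>" "\<And>k. w k \<in> borel_measurable \<pi>" "\<And>k x. 0 \<le> w k x"
      "\<And>x. summable (\<lambda>k. w k x / fact k * t ^ k)" for t f and w :: "nat \<Rightarrow> 'a \<Rightarrow> real"
    using that by (rule nn_integral_weighted_series)
  have rho_sets: "sets (\<rho> t) = sets borel" for t by (simp add: \<rho>_def poissonized_law_def)
  have emu: "(\<integral>\<^sup>+x. ennreal (u k x) * indicator B x \<partial>\<pi>) = emeasure (\<mu> k) B" if "B \<in> sets borel" for k B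
    using that by (subst u(5)[symmetric], subst emeasure_density) (auto simp: sp)
  have rho: "density \<pi> (\<lambda>x. ennreal (v t x)) = \<rho> t" if t: "0 \<le> t" for t
  proof (rule measure_eqI)
    fix B assume "B \<in> sets (density \<pi> (\<lambda>x. ennreal (v t x)))"
    then have B: "B \<in> sets borel" by (simp add: sp)
    have "emeasure (density \<pi> (\<lambda>x. ennreal (v t x))) B = (\<integral>\<^sup>+x. ennreal (v t x) * indicator B x \<partial>\<pi>)"
      using B by (subst emeasure_density) (auto simp: sp)
    also have "\<dots> = (\<Sum>k. ennreal (exp (- t) * t ^ k / fact k) * (\<integral>\<^sup>+x. ennreal (u k x) * indicator B x \<partial>\<pi>))"
      unfolding v_def by (rule mix) (use B in \<open>simp_all add: t u(2,4) um borel_measurable_indicator sp del: times_divide_eq_left\<close>)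
    also have "\<dots> = emeasure (\<rho> t) B"
      unfolding \<rho>_def emeasure_poissonized_law[OF M N Xm ind t B] emu[OF B] \<mu>_def ..
    finally show "emeasure (density \<pi> (\<lambda>x. ennreal (v t x))) B = emeasure (\<rho> t) B" .
  qed (simp add: rho_sets sp)
  \<comment> \<open>In every term of the mixture the recursion \<open>muS\<close> replaces
    \<open>u k\<close> by \<open>u (Suc k)\<close>, so one further step of the chain has density
    \<open>q t\<close>.\<close>
  have rhoQ: "density \<pi> (\<lambda>x. ennreal (q t x)) = bind (\<rho> t) K" if t: "0 \<le> t" for t
  proof (rule measure_eqI)
    have "space (\<rho> t) \<noteq> {}" using sets_eq_imp_space_eq[OF rho_sets[of t]] by simp
    then show "sets (density \<pi> (\<lambda>x. ennreal (q t x))) = sets (bind (\<rho> t) K)"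
      using sets_kernel[OF K'(1)] by (subst sets_bind[where N=borel]) (auto simp: sp)
    fix B assume "B \<in> sets (density \<pi> (\<lambda>x. ennreal (q t x)))"
    then have B: "B \<in> sets borel" by (simp add: sp)
    have mB[measurable]: "(\<lambda>x. emeasure (K x) B) \<in> borel_measurable \<pi>"
      by (rule measurable_compose[OF Kd[OF sp] measurable_emeasure_subprob_algebra[OF B]])
    have "emeasure (bind (\<rho> t) K) B = (\<integral>\<^sup>+x. emeasure (K x) B \<partial>\<rho> t)"
      by (rule emeasure_bind[OF \<open>space (\<rho> t) \<noteq> {}\<close> Kd[OF rho_sets] B])
    also have "\<dots> = (\<integral>\<^sup>+x. ennreal (v t x) * emeasure (K x) B \<partial>\<pi>)"
      unfolding rho[OF t, symmetric] by (subst nn_integral_density) auto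
    also have "\<dots> = (\<Sum>k. ennreal (exp (- t) * t ^ k / fact k) * (\<integral>\<^sup>+x. ennreal (u k x) * emeasure (K x) B \<partial>\<pi>))"
      unfolding v_def by (rule mix) (use t u um mB in auto)
    also have "(\<lambda>k. \<integral>\<^sup>+x. ennreal (u k x) * emeasure (K x) B \<partial>\<pi>) = (\<lambda>k. \<integral>\<^sup>+x. ennreal (u (Suc k) x) * indicator B x \<partial>\<pi>)"
    proof
      fix k
      have ne: "space (\<mu> k) \<noteq> {}" using prob_space.not_empty[OF mu(1)] .
      have "(\<integral>\<^sup>+x. ennreal (u k x) * emeasure (K x) B \<partial>\<pi>) = (\<integral>\<^sup>+x. emeasure (K x) B \<partial>\<mu> k)"
        unfolding u(5)[of k, symmetric] by (subst nn_integral_density) auto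
      also have "\<dots> = emeasure (\<mu> (Suc k)) B"
        unfolding muS by (rule emeasure_bind[symmetric, OF ne Kd[OF mu(2)] B])
      finally show "(\<integral>\<^sup>+x. ennreal (u k x) * emeasure (K x) B \<partial>\<pi>) = (\<integral>\<^sup>+x. ennreal (u (Suc k) x) * indicator B x \<partial>\<pi>)"
        unfolding emu[OF B] .
    qed
    also have "(\<Sum>k. ennreal (exp (- t) * t ^ k / fact k) * (\<integral>\<^sup>+x. ennreal (u (Suc k) x) * indicator B x \<partial>\<pi>)) =
        (\<integral>\<^sup>+x. ennreal (q t x) * indicator B x \<partial>\<pi>)"
      unfolding q_def by (rule mix[symmetric]) (use B in \<open>simp_all add: t u(2) us um borel_measurable_indicator sp del: times_divide_eq_left\<close>)
    also have "\<dots> = emeasure (density \<pi> (\<lambda>x. ennreal (q t x))) B"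
      using B by (subst emeasure_density) (auto simp: sp)
    finally show "emeasure (density \<pi> (\<lambda>x. ennreal (q t x))) B = emeasure (bind (\<rho> t) K) B" ..
  qed
  have dv: "AE x in \<pi>. dens \<pi> (\<rho> t) x = v t x" if t: "0 \<le> t" for t
    by (rule dens_density[OF _ vq'(1) vnn(1)[OF t] rho[OF t]]) unfold_locales
  have dens_borel: "dens \<pi> L \<in> borel_measurable borel" for L
    using dens_measurable[of \<pi> L] by (simp add: measurable_cong_sets[OF sp refl])
  have dq: "AE x in \<pi>. dual_op \<pi> K (dens \<pi> (\<rho> t)) x = q t x" if t: "0 \<le> t" for t
  proof -
    have "density \<pi> (\<lambda>y. ennreal (dens \<pi> (\<rho> t) y)) = density \<pi> (\<lambda>x. ennreal (v t x))"
    proof (rule density_cong)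
      show "AE x in \<pi>. ennreal (dens \<pi> (\<rho> t) x) = ennreal (v t x)" using dv[OF t] by eventually_elim simp
    qed measurable
    then have d: "density \<pi> (\<lambda>y. ennreal (dens \<pi> (\<rho> t) y)) = \<rho> t" using rho[OF t] by simp
    have "AE x in \<pi>. dens \<pi> (bind (\<rho> t) K) x = q t x"
      by (rule dens_density[OF _ vq'(2) vnn(2)[OF t] rhoQ[OF t]]) unfold_locales
    moreover have "AE x in \<pi>. dual_op \<pi> K (dens \<pi> (\<rho> t)) x = dens \<pi> (bind (\<rho> t) K) x"
      using dual_op_nonneg[OF pi.prob_space_axioms sp K'(1), of "dens \<pi> (\<rho> t)", OF dens_borel dens_nonneg]
      unfolding d .
    ultimately show ?thesis by eventually_elim simp
  qed
  \<comment> \<open>The entropy hypothesis on the dual operator is transferred to its version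
    \<open>q\<close>, whose series form is the one that \<open>entropy_step\<close> asks
    for.\<close>
  have entq: "integrable \<pi> (\<lambda>x. q t x * ln (q t x))" if t: "0 \<le> t" for t
  proof -
    have "AE x in \<pi>. dual_op \<pi> K (dens \<pi> (\<rho> t)) x * ln (dual_op \<pi> K (dens \<pi> (\<rho> t)) x) = q t x * ln (q t x)"
      using dq[OF t] by eventually_elim simp
    moreover have "dual_op \<pi> K (dens \<pi> (\<rho> t)) \<in> borel_measurable \<pi>"
      unfolding dual_op_def[abs_def] by measurable
    ultimately show ?thesis
      using ent[OF t] by (subst (asm) integrable_cong_AE) (auto simp: \<rho>_def)
  qed
  have du: "AE x in \<pi>. dens \<pi> \<mu>0 x = u 0 x"
    by (rule dens_density[OF _ um u(2)]) (use u(5)[of 0] mu0 in \<open>auto intro: pi.sigma_finite_measure_axioms\<close>)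
  have mu0': "prob_space \<mu>0" "sets \<mu>0 = sets \<pi>" using mu[of 0] by (auto simp: mu0 sp)
  note KLf = KL_finiteD[OF pi.prob_space_axioms mu0' KL]
  have phi: "AE x in \<pi>. dens \<pi> \<mu>0 x * ln (dens \<pi> \<mu>0 x) = u 0 x * ln (u 0 x)"
    using du by eventually_elim simp
  have ent0: "integrable \<pi> (\<lambda>x. u 0 x * ln (u 0 x))"
    using KLf(1) by (subst (asm) integrable_cong_AE[OF _ _ phi]) auto
  have KL0: "real_of_ereal (KL \<mu>0 \<pi>) = (\<integral>x. u 0 x * ln (u 0 x) \<partial>\<pi>)"
    unfolding KLf(2) by (rule integral_cong_AE[OF _ _ phi]) auto
  interpret F: poisson_density_flow \<pi> P K u c
  proof (intro poisson_density_flow.intro poisson_density_flow_axioms.intro)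
    show "density \<pi> (\<lambda>x. ennreal (u (Suc k) x)) = bind (density \<pi> (\<lambda>x. ennreal (u k x))) K" for k
      unfolding u(5) by (rule muS)
    show "prob_space (density \<pi> (\<lambda>x. ennreal (u 0 x)))" unfolding u(5) by (rule mu)
    show "integrable \<pi> (\<lambda>x. exp (- t) * (\<Sum>k. u (Suc k) x / fact k * t ^ k) *
        ln (exp (- t) * (\<Sum>k. u (Suc k) x / fact k * t ^ k)))" if "0 \<le> t" for t
      using entq[OF that] unfolding q_def .
  qed (fact pi.prob_space_axioms sp P K inv u(1-4) c(1) ent0)+
  have vF: "F.v = v" by (simp add: fun_eq_iff F.v_def v_def)
  \<comment> \<open>For \<open>P\<close> the absolute continuity is invariance of \<pi>; for
    \<open>K\<close> it is \<open>acK\<close> applied to \<pi> itself.\<close>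
  have acpi: "absolutely_continuous \<pi> (bind \<pi> P)" "absolutely_continuous \<pi> (bind \<pi> K)"
    using acK[OF pi] by (auto simp: inv absolutely_continuous_def)
  note ec = expansion_cong[OF sp K'(2,1) acpi dens_borel vq(1) dv]
  have T: "set_integrable lborel {0..T} (\<lambda>t. expansion_term \<pi> P K (dens \<pi> (\<rho> t)))"
    "(LINT t:{0..T}|lborel. expansion_term \<pi> P K (dens \<pi> (\<rho> t))) = (LINT t:{0..T}|lborel. expansion_term \<pi> P K (v t))"
    if T: "0 \<le> T" for T
  proof -
    have eq: "indicator {0..T} t *\<^sub>R expansion_term \<pi> P K (dens \<pi> (\<rho> t)) =
      indicator {0..T} t *\<^sub>R expansion_term \<pi> P K (v t)" for t
      using ec(1) by (auto split: split_indicator)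
    show "set_integrable lborel {0..T} (\<lambda>t. expansion_term \<pi> P K (dens \<pi> (\<rho> t)))"
      using F.expansion_set_integrable[OF T] unfolding set_integrable_def eq vF .
    show "(LINT t:{0..T}|lborel. expansion_term \<pi> P K (dens \<pi> (\<rho> t))) = (LINT t:{0..T}|lborel. expansion_term \<pi> P K (v t))"
      unfolding set_lebesgue_integral_def eq ..
  qed
  show thesis
  proof (rule that[of v])
    fix t :: real assume t: "0 \<le> t"
    show "0 \<le> v t x" for x by (rule vnn(1)[OF t])
    show "integrable \<pi> (v t)" "(\<integral>x. v t x \<partial>\<pi>) = 1"
      using F.v_integrable[OF t] F.integral_v[OF t] by (simp_all add: vF)
    show "integrable \<pi> (\<lambda>x. v t x * ln (v t x))"
      using F.q_ln_v_integrable(2)[OF t] by (simp add: vF)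
    show "density \<pi> (\<lambda>x. ennreal (v t x)) = poissonized_law M X N t"
      using rho[OF t] by (simp add: \<rho>_def)
    show "expansion_defined \<pi> P K (dens \<pi> (poissonized_law M X N t))"
      using F.expansion_defined_v[OF t] ec(2)[OF t] by (simp add: vF \<rho>_def)
    show "set_integrable lborel {0..t} (\<lambda>t. expansion_term \<pi> P K (dens \<pi> (poissonized_law M X N t)))"
      using T(1)[OF t] by (simp add: \<rho>_def)
    show "(\<integral>x. v t x * ln (v t x) \<partial>\<pi>) \<le> real_of_ereal (KL \<mu>0 \<pi>) +
      (LINT t:{0..t}|lborel. expansion_term \<pi> P K (dens \<pi> (poissonized_law M X N t)))"
      using F.entropy_expansion[OF t] T(2)[OF t] by (simp add: vF \<rho>_def KL0)
  qed
qed

section \<open>Combination of the two bounds on a single event\<close>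

theorem theorem10:
  fixes M :: "'w measure" and \<mu>z :: "'z measure"
    and l :: "real^'d::finite \<Rightarrow> 'z \<Rightarrow> real" and \<Sigma> \<zeta> :: real and n :: nat
    and PS :: "(nat \<Rightarrow> 'z) \<Rightarrow> real^'d \<Rightarrow> (real^'d) measure"
    and P :: "real^'d \<Rightarrow> (real^'d) measure"
    and \<mu>0 \<pi> :: "(real^'d) measure"
    and X :: "(nat \<Rightarrow> 'z) \<Rightarrow> nat \<Rightarrow> 'w \<Rightarrow> real^'d"
    and N :: "real \<Rightarrow> 'w \<Rightarrow> nat"
  assumes "prob_space M"
    and "prob_space \<mu>z"
    and "n \<ge> 1"
    and "(\<lambda>(w, z). l w z) \<in> borel_measurable (borel \<Otimes>\<^sub>M \<mu>z)"
    and "\<And>w z. z \<in> space \<mu>z \<Longrightarrow> 0 \<le> l w z"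
    and "\<mu>0 \<in> space (prob_algebra borel)"
    and "\<And>S. S \<in> space (Pi\<^sub>M {..<n} (\<lambda>_. \<mu>z)) \<Longrightarrow> PS S \<in> borel \<rightarrow>\<^sub>M prob_algebra borel"
    and "\<And>S. S \<in> space (Pi\<^sub>M {..<n} (\<lambda>_. \<mu>z)) \<Longrightarrow> markov_chain M (PS S) \<mu>0 (X S)"
    and "poisson_process M 1 N"
    and "\<And>S. S \<in> space (Pi\<^sub>M {..<n} (\<lambda>_. \<mu>z)) \<Longrightarrow> indep_processes M (X S) N"
    and "P \<in> borel \<rightarrow>\<^sub>M prob_algebra borel"
    and "\<pi> \<in> space (prob_algebra borel)"
    and "bind \<pi> P = \<pi>"
    and "absolutely_continuous \<pi> \<mu>0"
    and "compatibility n \<mu>z \<pi> \<mu>0 PS (\<lambda>S. poissonized_law M (X S) N)"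
    and "0 \<le> \<Sigma>"
    and "subgaussian_loss \<mu>z l \<Sigma>"
    and "0 < \<zeta>" "\<zeta> < 1"
  shows "\<exists>A\<in>sets (Pi\<^sub>M {..<n} (\<lambda>_. \<mu>z)). 1 - \<zeta> \<le> measure (Pi\<^sub>M {..<n} (\<lambda>_. \<mu>z)) A \<and>
    (\<forall>S\<in>A. \<forall>T>0.
       integrable M (\<lambda>\<omega>. gen_gap \<mu>z n l S (poissonized (X S) N T \<omega>)) \<and>
       (\<forall>t\<in>{0..T}. expansion_defined \<pi> P (PS S) (dens \<pi> (poissonized_law M (X S) N t))) \<and>
       set_integrable lborel {0..T}
         (\<lambda>t. expansion_term \<pi> P (PS S) (dens \<pi> (poissonized_law M (X S) N t))) \<and>
       (\<integral>\<omega>. gen_gap \<mu>z n l S (poissonized (X S) N T \<omega>) \<partial>M)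
         \<le> 2 * \<Sigma> / sqrt (real n) *
           sqrt ((LINT t:{0..T}|lborel.
                    expansion_term \<pi> P (PS S) (dens \<pi> (poissonized_law M (X S) N t)))
                 + real_of_ereal (KL \<mu>0 \<pi>) + ln (3 / \<zeta>)))"
proof -
  let ?N = "Pi\<^sub>M {..<n} (\<lambda>_. \<mu>z)"
  note M = assms(1) and Z = assms(2) and n = assms(3) and l = assms(4) and PS = assms(7) and X = assms(8)
    and N = assms(9) and ind = assms(10) and P = assms(11) and pi = assms(12) and inv = assms(13)
    and ac0 = assms(14) and \<Sigma> = assms(16) and sub = assms(17) and \<zeta> = assms(18,19)
  note comp = assms(15)[unfolded compatibility_def]
  have pi': "prob_space \<pi>" "sets \<pi> = sets borel" using pi by (auto simp: space_prob_algebra)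
  \<comment> \<open>The event comes from \<open>pac_bayes\<close> alone, before \<open>S\<close> and
    \<open>T\<close> are introduced, so it serves all times at once.\<close>
  obtain A where A: "A \<in> sets ?N" "1 - \<zeta> \<le> measure ?N A"
    and bound: "\<And>S v. S \<in> A \<Longrightarrow> integrable \<pi> v \<Longrightarrow> (\<And>x. 0 \<le> v x) \<Longrightarrow> (\<integral>x. v x \<partial>\<pi>) = 1 \<Longrightarrow>
      integrable \<pi> (\<lambda>x. v x * ln (v x)) \<Longrightarrow>
      integrable \<pi> (\<lambda>x. v x * gen_gap \<mu>z n l S x) \<and>
      (\<integral>x. v x * gen_gap \<mu>z n l S x \<partial>\<pi>) \<le>
        2 * \<Sigma> / sqrt n * sqrt ((\<integral>x. v x * ln (v x) \<partial>\<pi>) + ln (3 / \<zeta>))"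
    using pac_bayes[OF Z n l sub \<Sigma> \<zeta> pi'] by blast
  show ?thesis
  proof (intro bexI[OF _ A(1)] conjI A(2) ballI allI impI)
    fix S T assume SA: "S \<in> A" and "0 < (T::real)"
    then have T: "0 \<le> T" by simp
    have S: "S \<in> space ?N" using sets.sets_into_space[OF A(1)] SA by blast
    let ?\<rho> = "poissonized_law M (X S) N"
    obtain v where v: "\<And>t x. 0 \<le> t \<Longrightarrow> 0 \<le> v t x" "\<And>t. 0 \<le> t \<Longrightarrow> integrable \<pi> (v t)"
      "\<And>t. 0 \<le> t \<Longrightarrow> (\<integral>x. v t x \<partial>\<pi>) = 1"
      "\<And>t. 0 \<le> t \<Longrightarrow> integrable \<pi> (\<lambda>x. v t x * ln (v t x))"
      "\<And>t. 0 \<le> t \<Longrightarrow> density \<pi> (\<lambda>x. ennreal (v t x)) = ?\<rho> t"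
      "\<And>t. 0 \<le> t \<Longrightarrow> expansion_defined \<pi> P (PS S) (dens \<pi> (?\<rho> t))"
      "\<And>T. 0 \<le> T \<Longrightarrow> set_integrable lborel {0..T} (\<lambda>t. expansion_term \<pi> P (PS S) (dens \<pi> (?\<rho> t)))"
      "\<And>T. 0 \<le> T \<Longrightarrow> (\<integral>x. v T x * ln (v T x) \<partial>\<pi>) \<le> real_of_ereal (KL \<mu>0 \<pi>) +
        (LINT t:{0..T}|lborel. expansion_term \<pi> P (PS S) (dens \<pi> (?\<rho> t)))"
    proof (rule poissonized_flow[OF M PS[OF S] X[OF S] N ind[OF S] P pi inv ac0])
      show "KL \<mu>0 \<pi> < \<infinity>" "\<exists>c>0. AE x in \<pi>. c \<le> dens \<pi> \<mu>0 x" using comp by blast+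
      show "absolutely_continuous \<pi> (bind \<mu> (PS S))"
        if "\<mu> \<in> space (prob_algebra borel)" "absolutely_continuous \<pi> \<mu>" for \<mu>
        using comp S that by blast
      show "integrable \<pi> (\<lambda>x. dual_op \<pi> (PS S) (dens \<pi> (?\<rho> t)) x * ln (dual_op \<pi> (PS S) (dens \<pi> (?\<rho> t)) x))"
        if "0 \<le> t" for t
        using comp S that by blast
    qed blast
    let ?G = "gen_gap \<mu>z n l S"
    have G: "?G \<in> borel_measurable borel"
      using measurable_compose[OF measurable_Pair1'[OF S] gen_gap_measurable[OF Z l, of n]] by simp
    then have G': "?G \<in> borel_measurable \<pi>" by (simp add: measurable_cong_sets[OF pi'(2) refl])
    have Y: "poissonized (X S) N T \<in> borel_measurable M"
      using X[OF S] N T by (intro poissonized_measurable) (auto simp: markov_chain_def poisson_process_def)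
    have vm: "v T \<in> borel_measurable \<pi>" "AE x in \<pi>. 0 \<le> v T x" using v(1,2)[OF T] by auto
    note b = bound[OF SA v(2)[OF T] v(1)[OF T] v(3)[OF T] v(4)[OF T]]
    \<comment> \<open>Expectations over \<open>M\<close> become integrals against the law
      \<open>?\<rho> T\<close>, and then against \<pi> with weight \<open>v T\<close>, which is the
      form that \<open>bound\<close> controls.\<close>
    have "integrable (?\<rho> T) ?G"
      unfolding v(5)[OF T, symmetric] by (subst integrable_real_density[OF vm G']) (use b in blast)
    then show "integrable M (\<lambda>\<omega>. ?G (poissonized (X S) N T \<omega>))"
      unfolding poissonized_law_def by (subst (asm) integrable_distr_eq[OF Y G])
    show "set_integrable lborel {0..T} (\<lambda>t. expansion_term \<pi> P (PS S) (dens \<pi> (?\<rho> t)))"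
      by (rule v(7)[OF T])
    have "(\<integral>\<omega>. ?G (poissonized (X S) N T \<omega>) \<partial>M) = (\<integral>x. ?G x \<partial>?\<rho> T)"
      unfolding poissonized_law_def by (rule integral_distr[OF Y G, symmetric])
    also have "\<dots> = (\<integral>x. v T x * ?G x \<partial>\<pi>)"
      unfolding v(5)[OF T, symmetric] by (rule integral_real_density[OF vm G'])
    also have "\<dots> \<le> 2 * \<Sigma> / sqrt n * sqrt ((\<integral>x. v T x * ln (v T x) \<partial>\<pi>) + ln (3 / \<zeta>))"
      using b by blast
    \<comment> \<open>The entropy at time \<open>T\<close> is replaced by the initial one plus the
      integrated expansion term; monotonicity uses \<open>0 \<le> \<Sigma>\<close>.\<close>
    also have "\<dots> \<le> 2 * \<Sigma> / sqrt n * sqrt ((LINT t:{0..T}|lborel.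
        expansion_term \<pi> P (PS S) (dens \<pi> (?\<rho> t))) + real_of_ereal (KL \<mu>0 \<pi>) + ln (3 / \<zeta>))"
      using v(8)[OF T] \<Sigma> by (intro mult_left_mono real_sqrt_le_mono) auto
    finally show "(\<integral>\<omega>. ?G (poissonized (X S) N T \<omega>) \<partial>M) \<le> 2 * \<Sigma> / sqrt n * sqrt ((LINT t:{0..T}|lborel.
        expansion_term \<pi> P (PS S) (dens \<pi> (?\<rho> t))) + real_of_ereal (KL \<mu>0 \<pi>) + ln (3 / \<zeta>))" .
    show "expansion_defined \<pi> P (PS S) (dens \<pi> (?\<rho> t))" if "t \<in> {0..T}" for t
      using that by (intro v(6)) auto
  qed
qed

end
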